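(* Let $(u^n)_{0\le n\le N}$, $u^n=p^n+\mathbf i q^n$ with $p^n,q^n$ real-valued functions on $\mathbb R$, be given by the mid-point scheme $$\mathbf i\,\frac{u^{n+1}-u^n}{\delta t}+\frac{\delta W_n}{\delta t}\,\Delta u^{n+\frac12}+|u^{n+\frac12}|^{2\sigma}u^{n+\frac12}=0,\qquad u^{n+\frac12}=\tfrac12(u^n+u^{n+1}).$$ Put $\bar\omega^n:=\int_{\mathbb R}dp^n\wedge dq^n\,dx$ and $Q(u^n):=\int_{\mathbb R}|u^n|^2\,dx$. Then the scheme preserves the stochastic symplectic structure and the charge conservation law, i.e. $$\bar\omega^{n+1}=\bar\omega^n,\qquad Q(u^{n+1})=Q(u^n),\qquad 0\le n\le N-1,\quad\text{a.s.}$$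
   Context: $W$ is a one-dimensional real-valued Brownian motion on a stochastic basis, $T>0$, $N\ge1$, $\delta t=T/N$, $t_n=n\,\delta t$, $\delta W_n=W(t_{n+1})-W(t_n)$, $\mathbf i$ is the imaginary unit, and $\sigma\le2$ is a positive integer. The scheme is a temporal semi-discretization of $\mathbf i\,du+\Delta u\circ dW(t)+|u|^{2\sigma}u\,dt=0$ on $\mathbb R_+\times\mathbb R$ (Stratonovich noise), started from $u^0=u_0$. $d$ denotes the exterior differential on the phase space, i.e. differentiation with respect to the initial datum: $dp^n$, $dq^n$ evaluated on a variation of the initial datum give the real and imaginary parts of the corresponding variation of $u^n$ (at the point $x$), and $(dp^n\wedge dq^n)(\xi,\eta)=dp^n(\xi)\,dq^n(\eta)-dp^n(\eta)\,dq^n(\xi)$. Numerical solutions are understood to be regular enough that these objects make sense. *)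

theory Defs
  imports "HOL-Probability.Probability"
begin

section \<open>The phase space: the Sobolev space of order one on the real line\<close>

definition square_integrable :: "(real \<Rightarrow> complex) \<Rightarrow> bool" where
  "square_integrable f \<longleftrightarrow>
     f \<in> borel_measurable lborel \<and> integrable lborel (\<lambda>x. (cmod (f x))\<^sup>2)"

text \<open>
  On the line the elements of the Sobolev space $H^1$ are taken as their continuous representatives,
  i.e. as the square-integrable, locally absolutely continuous functions whose derivative is
  square-integrable. The derivative \<open>g\<close> is determined up to a null set by the fundamental
  theorem of calculus.
\<close>

definition weak_derivative :: "(real \<Rightarrow> complex) \<Rightarrow> (real \<Rightarrow> complex) \<Rightarrow> bool" where
  "weak_derivative f g \<longleftrightarrow>
     square_integrable g \<and> (\<forall>a b. a \<le> b \<longrightarrow> f b - f a = (LINT x:{a..b}|lborel. g x))"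

lemma square_integrable_zero: "square_integrable (\<lambda>_. 0)"
  by (simp add: square_integrable_def)

lemma square_integrable_inner:
  assumes "square_integrable f" "square_integrable g"
  shows "integrable lborel (\<lambda>x. f x \<bullet> g x)"
proof (rule Bochner_Integration.integrable_bound)
  show "integrable lborel (\<lambda>x. (cmod (f x))\<^sup>2 + (cmod (g x))\<^sup>2)"
    using assms by (auto simp: square_integrable_def)
  show "(\<lambda>x. f x \<bullet> g x) \<in> borel_measurable lborel"
    using assms by (auto simp: square_integrable_def)
  have "\<bar>f x \<bullet> g x\<bar> \<le> (cmod (f x))\<^sup>2 + (cmod (g x))\<^sup>2" for x
  proof -
    have "\<bar>f x \<bullet> g x\<bar> \<le> cmod (f x) * cmod (g x)" by (rule Cauchy_Schwarz_ineq2)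
    also have "\<dots> \<le> (cmod (f x))\<^sup>2 + (cmod (g x))\<^sup>2"
      using sum_squares_bound[of "cmod (f x)" "cmod (g x)"]
        mult_nonneg_nonneg[of "cmod (f x)" "cmod (g x)"] by (simp del: mult_nonneg_nonneg)
    finally show ?thesis .
  qed
  then show "AE x in lborel. norm (f x \<bullet> g x) \<le> norm ((cmod (f x))\<^sup>2 + (cmod (g x))\<^sup>2)"
    by simp
qed

lemma square_integrable_add:
  assumes "square_integrable f" "square_integrable g"
  shows "square_integrable (\<lambda>x. f x + g x)"
proof -
  have "integrable lborel (\<lambda>x. f x \<bullet> f x + 2 * (f x \<bullet> g x) + g x \<bullet> g x)"
    using assms by (intro Bochner_Integration.integrable_add integrable_mult_right
        square_integrable_inner)
  moreover have "(cmod (f x + g x))\<^sup>2 = f x \<bullet> f x + 2 * (f x \<bullet> g x) + g x \<bullet> g x" for x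
    by (simp add: power2_norm_eq_inner inner_add inner_commute)
  ultimately show ?thesis using assms by (auto simp: square_integrable_def)
qed

lemma square_integrable_scaleR:
  assumes "square_integrable f"
  shows "square_integrable (\<lambda>x. r *\<^sub>R f x)"
  using assms by (auto simp: square_integrable_def power_mult_distrib)

lemma square_integrable_on_interval:
  assumes "square_integrable g"
  shows "set_integrable lborel {a..b} g"
  unfolding set_integrable_def
proof (rule Bochner_Integration.integrable_bound)
  have "integrable lborel (indicat_real {a..b})"
    by (intro integrable_real_indicator) (auto simp: emeasure_lborel_Icc_eq)
  then show "integrable lborel (\<lambda>x. indicat_real {a..b} x + (cmod (g x))\<^sup>2)"
    using assms by (simp add: square_integrable_def)
  show "(\<lambda>x. indicat_real {a..b} x *\<^sub>R g x) \<in> borel_measurable lborel"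
    using assms by (auto simp: square_integrable_def)
  have "t \<le> 1 + t\<^sup>2" for t :: real
    using sum_squares_bound[of t 1] by (smt (verit) one_power2 zero_le_power2)
  then show "AE x in lborel. norm (indicat_real {a..b} x *\<^sub>R g x)
      \<le> norm (indicat_real {a..b} x + (cmod (g x))\<^sup>2)"
    by (auto simp: indicator_def)
qed

lemma weak_derivative_zero: "weak_derivative (\<lambda>_. 0) (\<lambda>_. 0)"
  by (simp add: weak_derivative_def square_integrable_zero)

lemma weak_derivative_add:
  "weak_derivative f f' \<Longrightarrow> weak_derivative g g' \<Longrightarrow>
   weak_derivative (\<lambda>x. f x + g x) (\<lambda>x. f' x + g' x)"
  by (simp add: weak_derivative_def square_integrable_add square_integrable_on_interval
      set_integral_add add_diff_add)

lemma weak_derivative_scaleR: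
  "weak_derivative f f' \<Longrightarrow> weak_derivative (\<lambda>x. r *\<^sub>R f x) (\<lambda>x. r *\<^sub>R f' x)"
  by (simp add: weak_derivative_def square_integrable_scaleR set_integral_scaleR_right
      flip: scaleR_diff_right)

lemma AE_zero_if_intervals_zero:
  fixes g :: "real \<Rightarrow> complex"
  assumes g: "square_integrable g"
    and zero: "\<And>a b. a \<le> b \<Longrightarrow> (LINT x:{a..b}|lborel. g x) = 0"
  shows "AE x in lborel. g x = 0"
proof -
  have "AE x in lborel. indicat_real {-real k..real k} x *\<^sub>R g x = 0" for k
  proof (rule sigma_finite_measure.density_zero[OF sigma_finite_lborel])
    define h where "h = (\<lambda>x. indicat_real {-real k..real k} x *\<^sub>R g x)"
    have h: "integrable lborel h"
      unfolding h_def using square_integrable_on_interval[OF g] by (simp add: set_integrable_def)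
    have hs: "set_integrable lborel A h" if "A \<in> sets borel" for A
      unfolding set_integrable_def using that h by (intro integrable_mult_indicator) auto
    have int0: "(LINT x:{a..b}|lborel. h x) = 0" for a b
    proof -
      have "(LINT x:{a..b}|lborel. h x) = (LINT x:{max a (-real k)..min b (real k)}|lborel. g x)"
        unfolding set_lebesgue_integral_def h_def
        by (intro Bochner_Integration.integral_cong) (auto simp: indicator_def)
      also have "\<dots> = 0"
        by (cases "max a (-real k) \<le> min b (real k)") (rule zero, assumption, simp add: set_lebesgue_integral_def)
      finally show ?thesis .
    qed
    show "integrable lborel (\<lambda>x. indicat_real {-real k..real k} x *\<^sub>R g x)"
      using h by (simp add: h_def)
    fix A :: "real set" assume "A \<in> sets lborel"
    have total: "(LINT x:UNIV|lborel. h x) = 0"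
    proof -
      have "(LINT x:UNIV|lborel. h x) = (LINT x:{-real k..real k}|lborel. h x)"
        unfolding set_lebesgue_integral_def h_def
        by (intro Bochner_Integration.integral_cong) (auto simp: indicator_def)
      then show ?thesis using int0 by simp
    qed
    have "Int_stable (range (\<lambda>(a::real, b). {a..b}))"
      by (auto simp: Int_stable_def)
    moreover have "range (\<lambda>(a::real, b). {a..b}) \<subseteq> Pow UNIV" by simp
    moreover have "A \<in> sigma_sets UNIV (range (\<lambda>(a, b). {a..b}))"
      using \<open>A \<in> sets lborel\<close> by (simp add: borel_eq_atLeastAtMost)
    ultimately have "(LINT x:A|lborel. h x) = 0"
    proof (induction rule: sigma_sets_induct_disjoint)
      case (basic A)
      then show ?case using int0 by auto
    next
      case empty
      show ?case by (simp add: set_lebesgue_integral_def)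
    next
      case (compl A)
      have A: "A \<in> sets borel" using compl(1) by (simp add: borel_eq_atLeastAtMost)
      have "(LINT x:A \<union> (UNIV - A)|lborel. h x)
          = (LINT x:A|lborel. h x) + (LINT x:(UNIV - A)|lborel. h x)"
        using A by (intro set_integral_Un hs) auto
      then show ?case using compl total by simp
    next
      case (union A)
      have A: "A i \<in> sets borel" for i using union(2) by (auto simp: borel_eq_atLeastAtMost)
      have "(LINT x:(\<Union>i. A i)|lborel. h x) = (\<Sum>i. (LINT x:A i|lborel. h x))"
        using A union(1) by (intro lebesgue_integral_countable_add hs)
          (auto simp: disjoint_family_on_def)
      then show ?case using union by simp
    qed
    then show "(LINT x:A|lborel. indicat_real {-real k..real k} x *\<^sub>R g x) = 0"
      by (simp add: h_def)
  qed
  then have "AE x in lborel. \<forall>k::nat. indicat_real {-real k..real k} x *\<^sub>R g x = 0"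
    unfolding AE_all_countable by blast
  then show ?thesis
  proof (rule AE_mp, intro AE_I2 impI)
    fix x :: real assume *: "\<forall>k::nat. indicat_real {-real k..real k} x *\<^sub>R g x = 0"
    obtain k :: nat where "\<bar>x\<bar> \<le> real k" using real_arch_simple by blast
    then show "g x = 0" using *[rule_format, of k] by (auto simp: indicator_def abs_le_iff)
  qed
qed

lemma weak_derivative_AE_unique:
  assumes "weak_derivative f g" "weak_derivative f h"
  shows "AE x in lborel. g x = h x"
proof -
  have "weak_derivative (\<lambda>x. f x + (-1) *\<^sub>R f x) (\<lambda>x. g x + (-1) *\<^sub>R h x)"
    using assms by (intro weak_derivative_add weak_derivative_scaleR)
  then have "AE x in lborel. g x + (-1) *\<^sub>R h x = 0"
    by (intro AE_zero_if_intervals_zero) (auto simp: weak_derivative_def)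
  then show ?thesis by simp
qed

typedef sobolev1 = "{f. square_integrable f \<and> (\<exists>g. weak_derivative f g)}"
  morphisms fn Abs_sobolev1
  using square_integrable_zero weak_derivative_zero by blast

setup_lifting type_definition_sobolev1

definition wderiv :: "sobolev1 \<Rightarrow> real \<Rightarrow> complex" where
  "wderiv f = (SOME g. weak_derivative (fn f) g)"

lemma square_integrable_fn: "square_integrable (fn f)"
  using fn[of f] by simp

lemma weak_derivative_wderiv: "weak_derivative (fn f) (wderiv f)"
proof -
  have "\<exists>g. weak_derivative (fn f) g" using fn[of f] by simp
  then show ?thesis unfolding wderiv_def by (rule someI_ex)
qed

lemma square_integrable_wderiv: "square_integrable (wderiv f)"
  using weak_derivative_wderiv[of f] by (simp add: weak_derivative_def)

instantiation sobolev1 :: real_vector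
begin

lift_definition zero_sobolev1 :: sobolev1 is "\<lambda>_. 0"
  using square_integrable_zero weak_derivative_zero by blast

lift_definition plus_sobolev1 :: "sobolev1 \<Rightarrow> sobolev1 \<Rightarrow> sobolev1" is "\<lambda>f g x. f x + g x"
  using square_integrable_add weak_derivative_add by blast

lift_definition scaleR_sobolev1 :: "real \<Rightarrow> sobolev1 \<Rightarrow> sobolev1" is "\<lambda>r f x. r *\<^sub>R f x"
  using square_integrable_scaleR weak_derivative_scaleR by blast

lift_definition uminus_sobolev1 :: "sobolev1 \<Rightarrow> sobolev1" is "\<lambda>f x. - f x"
  using square_integrable_scaleR[of _ "-1"] weak_derivative_scaleR[of _ _ "-1"] by fastforce

lift_definition minus_sobolev1 :: "sobolev1 \<Rightarrow> sobolev1 \<Rightarrow> sobolev1" is "\<lambda>f g x. f x - g x"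
  using square_integrable_add[OF _ square_integrable_scaleR[of _ "-1"]]
    weak_derivative_add[OF _ weak_derivative_scaleR[of _ _ "-1"]] by fastforce

instance
  by standard
    (transfer; simp add: fun_eq_iff algebra_simps)+

end

lemma wderiv_add: "AE x in lborel. wderiv (f + g) x = wderiv f x + wderiv g x"
proof (rule weak_derivative_AE_unique)
  show "weak_derivative (fn (f + g)) (wderiv (f + g))" by (rule weak_derivative_wderiv)
  show "weak_derivative (fn (f + g)) (\<lambda>x. wderiv f x + wderiv g x)"
    by (simp add: plus_sobolev1.rep_eq weak_derivative_add weak_derivative_wderiv)
qed

lemma wderiv_scaleR: "AE x in lborel. wderiv (r *\<^sub>R f) x = r *\<^sub>R wderiv f x"
proof (rule weak_derivative_AE_unique)
  show "weak_derivative (fn (r *\<^sub>R f)) (wderiv (r *\<^sub>R f))" by (rule weak_derivative_wderiv)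
  show "weak_derivative (fn (r *\<^sub>R f)) (\<lambda>x. r *\<^sub>R wderiv f x)"
    by (simp add: scaleR_sobolev1.rep_eq weak_derivative_scaleR weak_derivative_wderiv)
qed

text \<open>
  The complex Hilbert space is regarded as a real one: \<open>\<bullet>\<close> on \<^typ>\<open>complex\<close> is
  the real part of the Hermitian product.
\<close>

instantiation sobolev1 :: real_inner
begin

definition inner_sobolev1 :: "sobolev1 \<Rightarrow> sobolev1 \<Rightarrow> real" where
  "f \<bullet> g = (LINT x|lborel. fn f x \<bullet> fn g x) + (LINT x|lborel. wderiv f x \<bullet> wderiv g x)"

definition norm_sobolev1 :: "sobolev1 \<Rightarrow> real" where "norm (f :: sobolev1) = sqrt (f \<bullet> f)"

definition dist_sobolev1 :: "sobolev1 \<Rightarrow> sobolev1 \<Rightarrow> real" where "dist (f :: sobolev1) g = norm (f - g)"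

definition sgn_sobolev1 :: "sobolev1 \<Rightarrow> sobolev1" where "sgn (f :: sobolev1) = f /\<^sub>R norm f"

definition uniformity_sobolev1 :: "(sobolev1 \<times> sobolev1) filter" where
  "uniformity = (INF e\<in>{0<..}. principal {(f :: sobolev1, g). dist f g < e})"

definition open_sobolev1 :: "sobolev1 set \<Rightarrow> bool" where
  "open (U :: sobolev1 set) \<longleftrightarrow>
     (\<forall>f\<in>U. \<forall>\<^sub>F (f', g) in uniformity. f' = f \<longrightarrow> g \<in> U)"

instance
proof
  fix f g h :: sobolev1 and r :: real and U :: "sobolev1 set"
  note [simp] = square_integrable_inner square_integrable_fn square_integrable_wderiv
  have [measurable]: "wderiv k \<in> borel_measurable borel" for k
    using square_integrable_wderiv[of k] by (simp add: square_integrable_def)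
  show "dist f g = norm (f - g)" by (rule dist_sobolev1_def)
  show "sgn f = f /\<^sub>R norm f" by (rule sgn_sobolev1_def)
  show "uniformity = (INF e\<in>{0<..}. principal {(f :: sobolev1, g). dist f g < e})"
    by (rule uniformity_sobolev1_def)
  show "open U \<longleftrightarrow> (\<forall>f\<in>U. \<forall>\<^sub>F (f', g) in uniformity. f' = f \<longrightarrow> g \<in> U)"
    by (rule open_sobolev1_def)
  show "norm f = sqrt (f \<bullet> f)" by (rule norm_sobolev1_def)
  show "f \<bullet> g = g \<bullet> f" by (simp add: inner_sobolev1_def inner_commute)
  have "(LINT x|lborel. wderiv (f + g) x \<bullet> wderiv h x)
      = (LINT x|lborel. wderiv f x \<bullet> wderiv h x + wderiv g x \<bullet> wderiv h x)"
    using wderiv_add[of f g] by (intro integral_cong_AE) (auto simp: inner_add_left)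
  then show "(f + g) \<bullet> h = f \<bullet> h + g \<bullet> h"
    by (simp add: inner_sobolev1_def plus_sobolev1.rep_eq inner_add_left)
  have "(LINT x|lborel. wderiv (r *\<^sub>R f) x \<bullet> wderiv g x)
      = (LINT x|lborel. r * (wderiv f x \<bullet> wderiv g x))"
    using wderiv_scaleR[of r f] by (intro integral_cong_AE) auto
  then show "(r *\<^sub>R f) \<bullet> g = r * (f \<bullet> g)"
    by (simp add: inner_sobolev1_def scaleR_sobolev1.rep_eq distrib_left)
  show "0 \<le> f \<bullet> f" by (simp add: inner_sobolev1_def)
  show "f \<bullet> f = 0 \<longleftrightarrow> f = 0"
  proof
    assume "f \<bullet> f = 0"
    moreover have "0 \<le> (LINT x|lborel. fn f x \<bullet> fn f x)"
      "0 \<le> (LINT x|lborel. wderiv f x \<bullet> wderiv f x)" by simp_all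
    ultimately have "(LINT x|lborel. fn f x \<bullet> fn f x) = 0"
      "(LINT x|lborel. wderiv f x \<bullet> wderiv f x) = 0"
      unfolding inner_sobolev1_def by linarith+
    then have ae: "AE x in lborel. fn f x = 0" "AE x in lborel. wderiv f x = 0"
      by (simp_all add: integral_nonneg_eq_0_iff_AE)
    have const: "fn f b = fn f a" if "a \<le> b" for a b
    proof -
      have "(LINT x:{a..b}|lborel. wderiv f x) = 0"
        unfolding set_lebesgue_integral_def
        by (rule integral_eq_zero_AE) (use ae(2) in eventually_elim, simp)
      then show ?thesis
        using weak_derivative_wderiv[of f] that unfolding weak_derivative_def
        by (metis eq_iff_diff_eq_0)
    qed
    have "fn f x = 0" for x
    proof -
      have "\<exists>y. fn f y = 0"
      proof (rule ccontr)
        assume "\<nexists>y. fn f y = 0"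
        then have "AE x in (lborel :: real measure). False" using ae(1) by simp
        then have "UNIV \<in> null_sets (lborel :: real measure)" by (simp add: AE_iff_null_sets)
        then show False by (auto simp: null_sets_def)
      qed
      then obtain y where "fn f y = 0" ..
      then show ?thesis using const[of x y] const[of y x] by (cases "x \<le> y") auto
    qed
    then show "f = 0" by transfer (auto simp: fun_eq_iff)
  next
    assume "f = 0"
    have "AE x in lborel. wderiv (0 :: sobolev1) x = 0"
      using wderiv_scaleR[of 0 0] by simp
    then have "(LINT x|lborel. wderiv (0 :: sobolev1) x \<bullet> wderiv 0 x) = 0"
      by (intro integral_eq_zero_AE) auto
    then show "f \<bullet> f = 0"
      by (simp add: \<open>f = 0\<close> inner_sobolev1_def zero_sobolev1.rep_eq)
  qed
qed

end


section \<open>Brownian motion on a stochastic basis\<close>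

text \<open>Times are real numbers; only nonnegative ones carry information.\<close>

definition stochastic_basis :: "'w measure \<Rightarrow> (real \<Rightarrow> 'w measure) \<Rightarrow> bool" where
  "stochastic_basis M F \<longleftrightarrow>
     prob_space M \<and> filtration (space M) F \<and> (\<forall>t. sets (F t) \<subseteq> sets M)"

definition brownian_motion ::
    "'w measure \<Rightarrow> (real \<Rightarrow> 'w measure) \<Rightarrow> (real \<Rightarrow> 'w \<Rightarrow> real) \<Rightarrow> bool" where
  "brownian_motion M F W \<longleftrightarrow>
     (\<forall>t\<ge>0. W t \<in> borel_measurable (F t)) \<and>
     (AE \<omega> in M. W 0 \<omega> = 0) \<and>
     (AE \<omega> in M. continuous_on {0..} (\<lambda>t. W t \<omega>)) \<and>
     (\<forall>s t. 0 \<le> s \<longrightarrow> s < t \<longrightarrow>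
        distributed M lborel (\<lambda>\<omega>. W t \<omega> - W s \<omega>) (normal_density 0 (sqrt (t - s))) \<and>
        prob_space.indep_set M (sets (F s))
          {(\<lambda>\<omega>. W t \<omega> - W s \<omega>) -` A \<inter> space M |A. A \<in> sets borel})"


section \<open>The mid-point scheme\<close>

definition has_laplacian :: "(real \<Rightarrow> complex) \<Rightarrow> (real \<Rightarrow> complex) \<Rightarrow> bool" where
  "has_laplacian f l \<longleftrightarrow>
     (\<exists>f'. \<forall>x. (f has_vector_derivative f' x) (at x) \<and> (f' has_vector_derivative l x) (at x))"

text \<open>
  The second derivative of the mid-point is a classical one. For elements of $H^1$ and
  \<open>dw \<noteq> 0\<close> this is no restriction compared with distributional solutions, since every other
  term of the equation is a continuous function of \<open>x\<close>. The end points \<open>f\<close>, \<open>g\<close> of a step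
  need not be differentiable.
\<close>

definition midpoint_step :: "nat \<Rightarrow> real \<Rightarrow> real \<Rightarrow> sobolev1 \<Rightarrow> sobolev1 \<Rightarrow> bool" where
  "midpoint_step \<sigma> dt dw f g \<longleftrightarrow>
     (let m = (1/2) *\<^sub>R (f + g) in
      \<exists>l. has_laplacian (fn m) l \<and>
        (\<forall>x. \<i> * ((fn g x - fn f x) / complex_of_real dt)
              + complex_of_real (dw / dt) * l x
              + complex_of_real (cmod (fn m x) ^ (2 * \<sigma>)) * fn m x = 0))"

definition midpoint_scheme ::
    "nat \<Rightarrow> real \<Rightarrow> nat \<Rightarrow> (real \<Rightarrow> real) \<Rightarrow> sobolev1 \<Rightarrow> (nat \<Rightarrow> sobolev1) \<Rightarrow> bool" where
  "midpoint_scheme \<sigma> T N w u0 u \<longleftrightarrow>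
     (let dt = T / real N; t = (\<lambda>n. real n * dt) in
      u 0 = u0 \<and>
      (\<forall>n<N. midpoint_step \<sigma> dt (w (t (Suc n)) - w (t n)) (u n) (u (Suc n))))"

text \<open>
  Pathwise regularity in the initial datum: \<open>U n \<phi>\<close> is the \<open>n\<close>-th iterate started from
  \<open>\<phi>\<close>. It solves the scheme for all data in an \<open>H\<^sup>1\<close>-neighbourhood (which may depend on the path)
  of \<open>u0\<close> and is Frechet differentiable at \<open>u0\<close>. No global existence or uniqueness for
  the implicit equation is required.
\<close>

definition differentiable_midpoint_flow ::
    "nat \<Rightarrow> real \<Rightarrow> nat \<Rightarrow> (real \<Rightarrow> real) \<Rightarrow> sobolev1 \<Rightarrow> (nat \<Rightarrow> sobolev1 \<Rightarrow> sobolev1) \<Rightarrow> bool" where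
  "differentiable_midpoint_flow \<sigma> T N w u0 U \<longleftrightarrow>
     (\<forall>\<^sub>F \<phi> in nhds u0. midpoint_scheme \<sigma> T N w \<phi> (\<lambda>n. U n \<phi>)) \<and>
     (\<forall>n\<le>N. U n differentiable (at u0))"


section \<open>The conserved quantities\<close>

definition charge :: "sobolev1 \<Rightarrow> real" where
  "charge f = (LINT x|lborel. (cmod (fn f x))\<^sup>2)"

text \<open>
  \<open>ext_d p u0\<close> is the differential at \<open>u0\<close> of a real function \<open>p\<close> on the phase space.
\<close>

definition ext_d :: "(sobolev1 \<Rightarrow> real) \<Rightarrow> sobolev1 \<Rightarrow> sobolev1 \<Rightarrow> real" where
  "ext_d p u0 = frechet_derivative p (at u0)"

definition wedge :: "('v \<Rightarrow> real) \<Rightarrow> ('v \<Rightarrow> real) \<Rightarrow> 'v \<Rightarrow> 'v \<Rightarrow> real" where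
  "wedge \<alpha> \<beta> \<xi> \<eta> = \<alpha> \<xi> * \<beta> \<eta> - \<alpha> \<eta> * \<beta> \<xi>"

text \<open>
  The integral over \<open>x\<close> of \<open>dp \<and> dq\<close>, a two-form on the phase space evaluated at the
  initial datum \<open>u0\<close>, where \<open>p\<close> and \<open>q\<close> are the real and imaginary parts of
  \<open>U\<close> as functions of the initial datum.
\<close>

definition symplectic_form ::
    "(sobolev1 \<Rightarrow> sobolev1) \<Rightarrow> sobolev1 \<Rightarrow> sobolev1 \<Rightarrow> sobolev1 \<Rightarrow> real" where
  "symplectic_form U u0 \<xi> \<eta> =
     (LINT x|lborel.
        wedge (ext_d (\<lambda>\<phi>. Re (fn (U \<phi>) x)) u0) (ext_d (\<lambda>\<phi>. Im (fn (U \<phi>) x)) u0) \<xi> \<eta>)"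

end

theory Submission
  imports Defs
begin

text \<open>
  Both claims are pathwise and deterministic. Charge: the increment
  of the squared modulus is twice the real inner product of the midpoint with the increment of the
  step; inserting the scheme, the nonlinearity drops out pointwise and the Laplacian by Green's
  identity.

  Symplecticity is obtained without linearising the scheme. For three solutions of one step, with
  differences from the first one \<open>X \<mapsto> X'\<close>, \<open>Y \<mapsto> Y'\<close> and midpoint differences \<open>a\<close>, \<open>b\<close>,
  bilinearity gives \<open>\<omega>(X', Y') - \<omega>(X, Y) = \<omega>(X' - X, b) + \<omega>(a, Y' - Y)\<close>. Inserting the scheme,
  the Laplacians cancel exactly by Green's identity, and the nonlinearity leaves an error of third
  order in \<open>a, b\<close> because its derivative is symmetric. Applied to initial data
  \<open>u0 + t \<xi>\<close>, \<open>u0 + t \<eta>\<close> and divided by \<open>t\<^sup>2\<close>, the error vanishes as \<open>t \<rightarrow> 0\<close>.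
\<close>

section \<open>Integration by parts on the whole line\<close>

text \<open>
  The integral of \<open>H (x + 1) - H x\<close> vanishes by translation invariance and equals that of \<open>h\<close> by
  Fubini; this avoids any discussion of the limits of \<open>H\<close> at infinity.
\<close>

lemma integral_derivative_eq_0:
  fixes H h :: "real \<Rightarrow> real"
  assumes deriv: "\<And>x. (H has_real_derivative h x) (at x)"
    and H: "integrable lborel H" and h: "integrable lborel h"
  shows "(LINT x|lborel. h x) = 0"
proof -
  have [measurable]: "h \<in> borel_measurable borel" using h by auto
  have shift: "integrable lborel (\<lambda>x. f (x + s))" "(LINT x|lborel. f (x + s)) = (LINT x|lborel. f x)"
    if "integrable lborel f" for f :: "real \<Rightarrow> real" and s
    using lborel_integrable_real_affine[OF that, of 1 s] lborel_integral_real_affine[of 1 f s]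
    by (simp_all add: add.commute)
  have window: "(LINT s|lborel. indicat_real {0..1} s * h (x + s)) = H (x + 1) - H x" for x
  proof -
    have "((\<lambda>s. h (x + s)) has_integral (H (x + 1) - H (x + 0))) {0..1}"
      by (rule fundamental_theorem_of_calculus)
        (auto simp flip: has_real_derivative_iff_has_vector_derivative
          intro!: DERIV_subset[OF DERIV_shift[THEN iffD1, OF deriv, folded add.commute]]
          simp: add.commute)
    moreover have "set_integrable lborel {0..1} (\<lambda>s. h (x + s))"
      unfolding set_integrable_def using shift[OF h, of x]
      by (intro integrable_mult_indicator) (auto simp: add.commute)
    ultimately show ?thesis
      using set_borel_integral_eq_integral(2)[of "{0..1}" "\<lambda>s. h (x + s)"]
      by (auto simp: set_lebesgue_integral_def integral_unique)
  qed
  have "integrable (lborel \<Otimes>\<^sub>M lborel) (\<lambda>(s, x). indicat_real {0..1} s * h (x + s))"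
  proof (rule lborel_pair.Fubini_integrable)
    \<comment> \<open>By translation invariance the inner integral of the modulus is the same for
      every shift \<open>s\<close>, so the outer integrand is a constant times the indicator of the
      unit interval.\<close>
    show "integrable lborel (\<lambda>s. LINT x|lborel.
        norm (case (s, x) of (s, x) \<Rightarrow> indicat_real {0..1} s * h (x + s)))"
      using shift(2)[OF integrable_abs[OF h]] by (simp add: abs_mult)
  qed (use shift(1)[OF h] in auto)
  then have "(LINT x|lborel. LINT s|lborel. indicat_real {0..1} s * h (x + s))
      = (LINT s|lborel. LINT x|lborel. indicat_real {0..1} s * h (x + s))"
    using lborel_pair.Fubini_integral[of "\<lambda>s x. indicat_real {0..1} s * h (x + s)"] by simp
  also have "\<dots> = (LINT x|lborel. h x)"
    by (simp add: shift(2)[OF h])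
  finally show ?thesis
    using shift[OF H, of 1] H by (simp add: window)
qed

text \<open>The classical and the weak derivative have the same integral over every interval, namely
  the increment of \<open>f\<close>, and therefore agree almost everywhere. The criterion for
  vanishing almost everywhere asks for square integrability, which is what is to be proved for
  \<open>f'\<close>; hence the comparison on windows, where \<open>f'\<close> is bounded by
  continuity, followed by their countable union.\<close>

lemma square_integrable_classical_derivative:
  assumes weak: "weak_derivative f g"
    and classical: "\<And>x. (f has_vector_derivative f' x) (at x)"
    and cont: "continuous_on UNIV f'"
  shows "square_integrable f'"
proof -
  have g: "square_integrable g" using weak by (simp add: weak_derivative_def)
  have f'_meas [measurable]: "f' \<in> borel_measurable borel"
    using cont by (rule borel_measurable_continuous_onI)
  have g_meas [measurable]: "g \<in> borel_measurable borel"
    using g by (simp add: square_integrable_def)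
  have f'_int: "set_integrable lborel {a..b} f'" for a b
    unfolding set_integrable_def
    by (rule borel_integrable_compact) (auto intro: continuous_on_subset[OF cont])
  have f'_FTC: "(LINT x:{a..b}|lborel. f' x) = f b - f a" if "a \<le> b" for a b
    using fundamental_theorem_of_calculus[OF that, of f f']
      has_vector_derivative_at_within[OF classical]
      set_borel_integral_eq_integral(2)[OF f'_int] by (simp add: integral_unique)
  have "AE x in lborel. indicat_real {-real k..real k} x *\<^sub>R (f' x - g x) = 0" for k
  proof (rule AE_zero_if_intervals_zero)
    have "bounded (f' ` {-real k..real k})"
      by (intro compact_imp_bounded compact_continuous_image continuous_on_subset[OF cont]) auto
    then obtain B where B: "\<And>x. x \<in> {-real k..real k} \<Longrightarrow> cmod (f' x) \<le> B"
      unfolding bounded_iff by blast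
    have "square_integrable (\<lambda>x. indicat_real {-real k..real k} x *\<^sub>R f' x)"
      unfolding square_integrable_def
    proof (rule conjI[OF _ Bochner_Integration.integrable_bound])
      show "integrable lborel (\<lambda>x. B\<^sup>2 * indicat_real {-real k..real k} x)"
        by (intro integrable_mult_right integrable_real_indicator) (auto simp: emeasure_lborel_Icc_eq)
      show "AE x in lborel. norm ((cmod (indicat_real {-real k..real k} x *\<^sub>R f' x))\<^sup>2)
          \<le> norm (B\<^sup>2 * indicat_real {-real k..real k} x)"
      proof (intro AE_I2)
        fix x
        show "norm ((cmod (indicat_real {-real k..real k} x *\<^sub>R f' x))\<^sup>2)
          \<le> norm (B\<^sup>2 * indicat_real {-real k..real k} x)"
          using power_mono[OF B[of x], of 2] by (cases "x \<in> {-real k..real k}") simp_all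
      qed
    qed measurable
    moreover have "square_integrable (\<lambda>x. indicat_real {-real k..real k} x *\<^sub>R g x)"
      unfolding square_integrable_def
    proof (rule conjI[OF _ Bochner_Integration.integrable_bound])
      show "integrable lborel (\<lambda>x. (cmod (g x))\<^sup>2)"
        using g by (simp add: square_integrable_def)
    qed (auto simp: indicator_def)
    ultimately show "square_integrable (\<lambda>x. indicat_real {-real k..real k} x *\<^sub>R (f' x - g x))"
      using square_integrable_add[OF _ square_integrable_scaleR[of _ "-1"]]
      by (fastforce simp: scaleR_diff_right)
  next
    fix a b :: real
    let ?a = "max a (-real k)" and ?b = "min b (real k)"
    have "(LINT x:{a..b}|lborel. indicat_real {-real k..real k} x *\<^sub>R (f' x - g x))
        = (LINT x:{?a..?b}|lborel. f' x - g x)"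
      unfolding set_lebesgue_integral_def
      by (intro Bochner_Integration.integral_cong) (auto simp: indicator_def)
    also have "\<dots> = 0"
    proof (cases "?a \<le> ?b")
      case True
      then show ?thesis
        using weak f'_FTC[OF True] f'_int[of ?a ?b] square_integrable_on_interval[OF g, of ?a ?b]
        by (simp add: set_integral_diff weak_derivative_def)
    next
      case False
      then show ?thesis by (simp add: set_lebesgue_integral_def)
    qed
    finally show "(LINT x:{a..b}|lborel. indicat_real {-real k..real k} x *\<^sub>R (f' x - g x)) = 0" .
  qed
  then have "AE x in lborel. \<forall>k::nat. indicat_real {-real k..real k} x *\<^sub>R (f' x - g x) = 0"
    unfolding AE_all_countable by blast
  then have "AE x in lborel. (cmod (g x))\<^sup>2 = (cmod (f' x))\<^sup>2"
  proof (rule AE_mp, intro AE_I2 impI)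
    fix x :: real
    assume *: "\<forall>k::nat. indicat_real {-real k..real k} x *\<^sub>R (f' x - g x) = 0"
    obtain k :: nat where "\<bar>x\<bar> \<le> real k" using real_arch_simple by blast
    then show "(cmod (g x))\<^sup>2 = (cmod (f' x))\<^sup>2"
      using *[rule_format, of k] by (auto simp: indicator_def abs_le_iff)
  qed
  then show ?thesis
    using g integrable_cong_AE[of "\<lambda>x. (cmod (g x))\<^sup>2" lborel "\<lambda>x. (cmod (f' x))\<^sup>2"]
    by (auto simp: square_integrable_def)
qed

text \<open>The integrand is the derivative of
  \<open>f' x \<bullet> g x - f x \<bullet> g' x\<close>, as the cross terms
  \<open>f' x \<bullet> g' x\<close> cancel. Both functions are integrable as sums of products of
  square-integrable ones; the weak derivatives serve to put \<open>f'\<close> and \<open>g'\<close>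
  into that class.\<close>

lemma Green_identity:
  assumes f: "square_integrable f" "weak_derivative f f1" and g: "square_integrable g" "weak_derivative g g1"
    and lap: "has_laplacian f l" "has_laplacian g k"
    and sq: "square_integrable l" "square_integrable k"
  shows "(LINT x|lborel. l x \<bullet> g x - f x \<bullet> k x) = 0"
proof -
  obtain f' g' where
    f': "\<And>x. (f has_vector_derivative f' x) (at x)" "\<And>x. (f' has_vector_derivative l x) (at x)" and
    g': "\<And>x. (g has_vector_derivative g' x) (at x)" "\<And>x. (g' has_vector_derivative k x) (at x)"
    using lap unfolding has_laplacian_def by metis
  have "square_integrable f'" "square_integrable g'"
    using f' g'
    by (auto intro!: square_integrable_classical_derivative[OF f(2) f'(1)]
        square_integrable_classical_derivative[OF g(2) g'(1)]
        has_vector_derivative_continuous continuous_at_imp_continuous_on)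
  note [intro!] = this sq f(1) g(1) square_integrable_inner Bochner_Integration.integrable_diff
  show ?thesis
  proof (rule integral_derivative_eq_0)
    fix x
    have "((\<lambda>x. f' x \<bullet> g x - f x \<bullet> g' x) has_vector_derivative
        (f' x \<bullet> g' x + l x \<bullet> g x - (f x \<bullet> k x + f' x \<bullet> g' x))) (at x)"
      by (intro has_vector_derivative_diff bounded_bilinear.has_vector_derivative[OF bounded_bilinear_inner]
          f' g')
    then show "((\<lambda>x. f' x \<bullet> g x - f x \<bullet> g' x) has_real_derivative (l x \<bullet> g x - f x \<bullet> k x)) (at x)"
      by (simp add: has_real_derivative_iff_has_vector_derivative)
  qed auto
qed

section \<open>Sobolev embedding and the symplectic pairing\<close>

lemma integral_norm_fn_le: "(LINT x|lborel. (cmod (fn f x))\<^sup>2) \<le> (norm f)\<^sup>2"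
proof -
  have "0 \<le> (LINT x|lborel. wderiv f x \<bullet> wderiv f x)" by simp
  then show ?thesis
    by (simp add: power2_norm_eq_inner inner_sobolev1_def)
qed

text \<open>The embedding of the Sobolev space into bounded functions. On a unit interval starting
  at \<open>x\<close>, the value at \<open>x\<close> differs from any other value by at most the
  integral of the modulus of the derivative; averaging finishes the bound. Normalising to
  \<open>norm f = 1\<close> first lets the elementary \<open>2 * t \<le> 1 + t\<^sup>2\<close>
  replace the Cauchy-Schwarz inequality for integrals, and the constant is
  \<open>1 + (norm f)\<^sup>2 = 2\<close>.\<close>

lemma norm_fn_le: "cmod (fn f x) \<le> 2 * norm f"
proof -
  have unit: "cmod (fn f x) \<le> 2" if "norm f = 1" for f
  proof -
    let ?I = "{x..x+1}"
    have *: "cmod (fn f x) \<le> cmod (fn f y) + (LINT y:?I|lborel. cmod (wderiv f y))" if "y \<in> ?I" for y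
    proof -
      have eq: "fn f x = fn f y - (LINT s:{x..y}|lborel. wderiv f s)"
        using conjunct2[OF weak_derivative_wderiv[of f, unfolded weak_derivative_def],
            THEN spec, THEN spec, of x y] that
        by (simp add: algebra_simps)
      have "cmod (LINT s:{x..y}|lborel. wderiv f s) \<le> (LINT s:{x..y}|lborel. cmod (wderiv f s))"
        by (rule set_integral_norm_bound) (rule square_integrable_on_interval[OF square_integrable_wderiv])
      moreover have "(LINT s:{x..y}|lborel. cmod (wderiv f s)) \<le> (LINT s:?I|lborel. cmod (wderiv f s))"
        unfolding set_lebesgue_integral_def
        using that set_integrable_norm[OF square_integrable_on_interval[OF square_integrable_wderiv]]
        by (intro integral_mono) (auto simp: set_integrable_def indicator_def)
      ultimately show ?thesis
        unfolding eq using norm_triangle_ineq4[of "fn f y" "LINT s:{x..y}|lborel. wderiv f s"] by linarith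
    qed
    note int = set_integrable_norm[OF square_integrable_on_interval[OF square_integrable_wderiv]]
      set_integrable_norm[OF square_integrable_on_interval[OF square_integrable_fn]]
    have sq_int': "integrable lborel (\<lambda>y. (cmod (fn f y))\<^sup>2 + (cmod (wderiv f y))\<^sup>2)"
      using square_integrable_fn[of f] square_integrable_wderiv[of f]
      by (simp add: square_integrable_def)
    then have sq_int: "set_integrable lborel ?I (\<lambda>y. (cmod (fn f y))\<^sup>2 + (cmod (wderiv f y))\<^sup>2)"
      unfolding set_integrable_def by (intro integrable_mult_indicator) auto
    have [simp]: "set_integrable lborel ?I (\<lambda>y. c)" for c :: real
      unfolding set_integrable_def by (intro borel_integrable_compact) auto
    \<comment> \<open>The interval has length one, so averaging leaves constants unchanged; this is
      used again for the inner integral and for the summand \<open>1\<close>.\<close>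
    have "cmod (fn f x) = (LINT y:?I|lborel. cmod (fn f x))" by (simp add: set_integral_const)
    also have "\<dots> \<le> (LINT y:?I|lborel. cmod (fn f y) + (LINT y:?I|lborel. cmod (wderiv f y)))"
      using * int by (intro set_integral_mono) auto
    also have "\<dots> = (LINT y:?I|lborel. cmod (fn f y) + cmod (wderiv f y))"
      using int by (simp add: set_integral_add set_integral_const)
    also have "\<dots> \<le> (LINT y:?I|lborel. 1 + ((cmod (fn f y))\<^sup>2 + (cmod (wderiv f y))\<^sup>2))"
    proof (intro set_integral_mono)
      fix y
      have "2 * cmod (fn f y) \<le> 1 + (cmod (fn f y))\<^sup>2"
        "2 * cmod (wderiv f y) \<le> 1 + (cmod (wderiv f y))\<^sup>2"
        using sum_squares_bound[of 1 "cmod (fn f y)"] sum_squares_bound[of 1 "cmod (wderiv f y)"]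
        by simp_all
      then show "cmod (fn f y) + cmod (wderiv f y) \<le> 1 + ((cmod (fn f y))\<^sup>2 + (cmod (wderiv f y))\<^sup>2)"
        using zero_le_power2[of "cmod (fn f y)"] zero_le_power2[of "cmod (wderiv f y)"] by linarith
    qed (use int sq_int in auto)
    also have "\<dots> = 1 + (LINT y:?I|lborel. ((cmod (fn f y))\<^sup>2 + (cmod (wderiv f y))\<^sup>2))"
      using sq_int by (simp add: set_integral_add set_integral_const)
    also have "\<dots> \<le> 1 + (LINT y|lborel. ((cmod (fn f y))\<^sup>2 + (cmod (wderiv f y))\<^sup>2))"
      unfolding set_lebesgue_integral_def
      using sq_int' by (intro add_left_mono integral_mono integrable_mult_indicator) (auto simp: indicator_def)
    also have "\<dots> = 1 + (norm f)\<^sup>2"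
      using square_integrable_fn[of f] square_integrable_wderiv[of f]
      by (simp add: power2_norm_eq_inner[of f] inner_sobolev1_def square_integrable_def flip: power2_norm_eq_inner)
    finally show ?thesis using that by simp
  qed
  show ?thesis
  proof (cases "f = 0")
    case False
    then show ?thesis
      using unit[of "f /\<^sub>R norm f"] by (simp add: scaleR_sobolev1.rep_eq field_simps)
  qed (simp add: zero_sobolev1.rep_eq)
qed


text \<open>Since \<open>(\<i> * z) \<bullet> w = Re z * Im w - Im z * Re w\<close>, this is the
  standard symplectic form on the phase space, that is, the integral over the line of the pointwise
  area form.\<close>

definition symplectic_pairing :: "sobolev1 \<Rightarrow> sobolev1 \<Rightarrow> real" where
  "symplectic_pairing f g = (LINT x|lborel. (\<i> * fn f x) \<bullet> fn g x)"

lemma fn_simps [simp]: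
  "fn (f + g) x = fn f x + fn g x" "fn (f - g) x = fn f x - fn g x" "fn (r *\<^sub>R f) x = r *\<^sub>R fn f x"
  by (simp_all add: plus_sobolev1.rep_eq minus_sobolev1.rep_eq scaleR_sobolev1.rep_eq)

text \<open>Continuity of point evaluation is what allows differentiation in the Sobolev norm to
  pass to the values at a fixed \<open>x\<close>.\<close>

lemma bounded_linear_fn: "bounded_linear (\<lambda>f. fn f x)"
  by (rule bounded_linear_intro[of _ 2]) (use norm_fn_le[of _ x] in \<open>simp_all add: mult.commute\<close>)

lemma integrable_norm_fn: "integrable lborel (\<lambda>x. (cmod (fn f x))\<^sup>2)"
  using square_integrable_fn[of f] by (simp add: square_integrable_def)

lemma square_integrable_mult_left:
  "square_integrable f \<Longrightarrow> square_integrable (\<lambda>x. c * f x)"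
  by (auto simp: square_integrable_def norm_mult power_mult_distrib)

lemma integrable_symplectic_pairing: "integrable lborel (\<lambda>x. (\<i> * fn f x) \<bullet> fn g x)"
  by (intro square_integrable_inner square_integrable_mult_left square_integrable_fn)

lemma mult_le_sum_squares: "a * b \<le> a\<^sup>2 + b\<^sup>2" if "0 \<le> a" "0 \<le> b" for a b :: real
  using sum_squares_bound[of a b] mult_nonneg_nonneg[OF that] by linarith

text \<open>Provides the continuity needed to pass to the limit in pairings of difference quotients.
  As in the embedding, the bound is shown for unit vectors and extended by homogeneity.\<close>

lemma bounded_bilinear_symplectic_pairing: "bounded_bilinear symplectic_pairing"
proof
  fix f g h :: sobolev1 and r :: real
  show "symplectic_pairing (f + g) h = symplectic_pairing f h + symplectic_pairing g h" "symplectic_pairing f (g + h) = symplectic_pairing f g + symplectic_pairing f h"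
    by (simp_all add: symplectic_pairing_def distrib_left inner_add integrable_symplectic_pairing)
  show scale: "symplectic_pairing (r *\<^sub>R f) g = r *\<^sub>R symplectic_pairing f g" "symplectic_pairing f (r *\<^sub>R g) = r *\<^sub>R symplectic_pairing f g"
    for r :: real and f g :: sobolev1
    by (simp_all add: symplectic_pairing_def)
  have unit: "\<bar>symplectic_pairing f g\<bar> \<le> 2" if "norm f = 1" "norm g = 1" for f g
  proof -
    have "\<bar>symplectic_pairing f g\<bar> \<le> (LINT x|lborel. \<bar>(\<i> * fn f x) \<bullet> fn g x\<bar>)"
      unfolding symplectic_pairing_def by (rule integral_abs_bound)
    also have "\<dots> \<le> (LINT x|lborel. (cmod (fn f x))\<^sup>2 + (cmod (fn g x))\<^sup>2)"
    proof (intro integral_mono integrable_abs integrable_symplectic_pairing Bochner_Integration.integrable_add integrable_norm_fn)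
      fix x
      show "\<bar>(\<i> * fn f x) \<bullet> fn g x\<bar> \<le> (cmod (fn f x))\<^sup>2 + (cmod (fn g x))\<^sup>2"
        using Cauchy_Schwarz_ineq2[of "\<i> * fn f x" "fn g x"]
          mult_le_sum_squares[of "cmod (fn f x)" "cmod (fn g x)"] by (simp add: norm_mult)
    qed
    also have "\<dots> \<le> (norm f)\<^sup>2 + (norm g)\<^sup>2"
      using integral_norm_fn_le[of f] integral_norm_fn_le[of g] by (simp add: integrable_norm_fn)
    finally show ?thesis using that by simp
  qed
  show "\<exists>K. \<forall>f g. norm (symplectic_pairing f g) \<le> norm f * norm g * K"
  proof (intro exI allI)
    fix f g :: sobolev1
    show "norm (symplectic_pairing f g) \<le> norm f * norm g * 2"
    proof (cases "f = 0 \<or> g = 0")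
      case True
      then show ?thesis using scale(1)[of 0 f g] scale(2)[of f 0 g] by (auto simp: symplectic_pairing_def zero_sobolev1.rep_eq)
    next
      case False
      then show ?thesis
        using unit[of "f /\<^sub>R norm f" "g /\<^sub>R norm g"]
        by (simp add: scale abs_mult field_simps)
    qed
  qed
qed

section \<open>The power nonlinearity and its Taylor expansion\<close>

text \<open>The even power is written through the squared modulus, which is a polynomial in the real
  coordinates, so that no special care is needed at \<open>z = 0\<close>.\<close>

definition nls :: "nat \<Rightarrow> complex \<Rightarrow> complex" where
  "nls \<sigma> z = (((cmod z)\<^sup>2) ^ \<sigma>) *\<^sub>R z"

lemma nls_altdef: "nls \<sigma> z = complex_of_real (cmod z ^ (2 * \<sigma>)) * z"
  by (simp only: nls_def power_mult scaleR_conv_of_real)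

text \<open>By the embedding the scalar factor is bounded, so the nonlinearity is dominated by a
  constant multiple of \<open>f\<close>.\<close>

lemma square_integrable_nls: "square_integrable (\<lambda>x. nls \<sigma> (fn f x))"
  unfolding square_integrable_def
proof (rule conjI[OF _ Bochner_Integration.integrable_bound])
  have [measurable]: "fn f \<in> borel_measurable borel"
    using square_integrable_fn[of f] by (simp add: square_integrable_def)
  show "(\<lambda>x. nls \<sigma> (fn f x)) \<in> borel_measurable lborel" "(\<lambda>x. (cmod (nls \<sigma> (fn f x)))\<^sup>2) \<in> borel_measurable lborel"
    unfolding nls_def by measurable
  show "integrable lborel (\<lambda>x. ((((2 * norm f)\<^sup>2) ^ \<sigma>)\<^sup>2) * (cmod (fn f x))\<^sup>2)"
    using integrable_norm_fn by simp
  have le: "cmod (nls \<sigma> (fn f x)) \<le> ((2 * norm f)\<^sup>2) ^ \<sigma> * cmod (fn f x)" for x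
    unfolding nls_def norm_scaleR
    using power_mono[OF power_mono[OF norm_fn_le norm_ge_zero, of f x 2] zero_le_power2, of \<sigma>]
    by (intro mult_right_mono) auto
  show "AE x in lborel. norm ((cmod (nls \<sigma> (fn f x)))\<^sup>2)
      \<le> norm (((((2 * norm f)\<^sup>2) ^ \<sigma>)\<^sup>2) * (cmod (fn f x))\<^sup>2)"
  proof (intro AE_I2)
    fix x
    show "norm ((cmod (nls \<sigma> (fn f x)))\<^sup>2) \<le> norm (((((2 * norm f)\<^sup>2) ^ \<sigma>)\<^sup>2) * (cmod (fn f x))\<^sup>2)"
      using power_mono[OF le norm_ge_zero, of x 2] by (simp add: power_mult_distrib)
  qed
qed

lemma power_Taylor:
  assumes "0 \<le> (R :: real)"
  shows "\<exists>C\<ge>0. \<forall>p\<in>{0..R}. \<forall>q\<in>{0..R}.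
    \<bar>q ^ k - p ^ k - real k * p ^ (k - 1) * (q - p)\<bar> \<le> C * (q - p)\<^sup>2"
proof (induction k)
  case 0
  then show ?case by auto
next
  case (Suc k)
  then obtain C where C: "C \<ge> 0" "\<And>p q. p \<in> {0..R} \<Longrightarrow> q \<in> {0..R} \<Longrightarrow>
    \<bar>q ^ k - p ^ k - real k * p ^ (k - 1) * (q - p)\<bar> \<le> C * (q - p)\<^sup>2" by blast
  show ?case
  proof (intro exI[of _ "R * C + real k * R ^ (k - 1)"] conjI ballI)
    fix p q assume pq: "p \<in> {0..R}" "q \<in> {0..R}"
    \<comment> \<open>Recursion for the second-order Taylor remainder, from which the witness is
      read off. The case split concerns the truncated exponent \<open>k - 1\<close>, harmless at
      \<open>k = 0\<close> because of the factor \<open>real k\<close>.\<close>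
    have "q ^ Suc k - p ^ Suc k - real (Suc k) * p ^ (Suc k - 1) * (q - p)
        = q * (q ^ k - p ^ k - real k * p ^ (k - 1) * (q - p)) + real k * p ^ (k - 1) * (q - p)\<^sup>2"
      by (cases k) (simp_all add: algebra_simps power2_eq_square)
    also have "\<bar>\<dots>\<bar> \<le> R * (C * (q - p)\<^sup>2) + real k * R ^ (k - 1) * (q - p)\<^sup>2"
      using pq C(1) C(2)[OF pq]
      by (intro order_trans[OF abs_triangle_ineq] add_mono)
        (auto simp: abs_mult intro!: mult_mono power_mono)
    finally show "\<bar>q ^ Suc k - p ^ Suc k - real (Suc k) * p ^ (Suc k - 1) * (q - p)\<bar>
        \<le> (R * C + real k * R ^ (k - 1)) * (q - p)\<^sup>2" by (simp add: algebra_simps)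
  qed (use C assms in auto)
qed

text \<open>The subtracted term is the real derivative of \<open>nls\<close> at \<open>z\<close> in
  direction \<open>a\<close>. The expansion of the power is taken between the squared moduli of
  \<open>z\<close> and \<open>z + a\<close>, both at most \<open>R\<^sup>2\<close>, and their
  difference is \<open>2 * (z \<bullet> a)\<close> up to the quadratic term
  \<open>(cmod a)\<^sup>2\<close>.\<close>

lemma nls_Taylor:
  assumes "0 \<le> R"
  shows "\<exists>C\<ge>0. \<forall>z a. cmod z \<le> R \<longrightarrow> cmod (z + a) \<le> R \<longrightarrow>
    cmod (nls \<sigma> (z + a) - nls \<sigma> z
        - (((cmod z)\<^sup>2) ^ \<sigma> *\<^sub>R a + (2 * real \<sigma> * ((cmod z)\<^sup>2) ^ (\<sigma> - 1) * (z \<bullet> a)) *\<^sub>R z))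
      \<le> C * (cmod a)\<^sup>2"
proof -
  obtain C where C: "C \<ge> 0" "\<And>p q. p \<in> {0..R\<^sup>2} \<Longrightarrow> q \<in> {0..R\<^sup>2} \<Longrightarrow>
    \<bar>q ^ \<sigma> - p ^ \<sigma> - real \<sigma> * p ^ (\<sigma> - 1) * (q - p)\<bar> \<le> C * (q - p)\<^sup>2"
    using power_Taylor[of "R\<^sup>2" \<sigma>] by auto
  define L where "L = real \<sigma> * (R\<^sup>2) ^ (\<sigma> - 1)"
  show ?thesis
  \<comment> \<open>The first two summands bound the coefficient of \<open>a\<close>, where one
    factor \<open>cmod a \<le> 2 * R\<close> is spent on the remainder of the power; the last one
    bounds the coefficient of \<open>z\<close>.\<close>
  proof (intro exI[of _ "8 * C * R ^ 3 + 2 * R * L + (4 * C * R\<^sup>2 + L) * R"] conjI allI impI)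
    fix z a assume z: "cmod z \<le> R" "cmod (z + a) \<le> R"
    define p q where "p = (cmod z)\<^sup>2" and "q = (cmod (z + a))\<^sup>2"
    define \<rho> where "\<rho> = q ^ \<sigma> - p ^ \<sigma> - real \<sigma> * p ^ (\<sigma> - 1) * (q - p)"
    define l where "l = real \<sigma> * p ^ (\<sigma> - 1)"
    have pq: "p \<in> {0..R\<^sup>2}" "q \<in> {0..R\<^sup>2}" using z by (auto simp: p_def q_def intro: power_mono)
    have l: "0 \<le> l" "l \<le> L" using pq by (auto simp: l_def L_def intro!: mult_left_mono power_mono)
    have qp: "q - p = 2 * (z \<bullet> a) + (cmod a)\<^sup>2"
      by (simp add: p_def q_def power2_norm_eq_inner inner_add inner_commute)
    have a: "cmod a \<le> 2 * R" using z norm_triangle_ineq4[of "z + a" z] by simp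
    have "q - p = (cmod (z + a) - cmod z) * (cmod (z + a) + cmod z)"
      by (simp add: p_def q_def power2_eq_square algebra_simps)
    then have "\<bar>q - p\<bar> = \<bar>cmod (z + a) - cmod z\<bar> * (cmod (z + a) + cmod z)"
      by (simp add: abs_mult)
    also have "\<dots> \<le> cmod a * (R + R)"
      using z norm_triangle_ineq3[of "z + a" z] by (intro mult_mono) auto
    finally have qp_le: "\<bar>q - p\<bar> \<le> 2 * R * cmod a" by (simp add: mult_ac)
    have "(q - p)\<^sup>2 \<le> (2 * R * cmod a)\<^sup>2"
      using qp_le by (metis abs_ge_zero power2_abs power_mono)
    then have \<rho>: "\<bar>\<rho>\<bar> \<le> 4 * C * R\<^sup>2 * (cmod a)\<^sup>2"
      using C(2)[OF pq] mult_left_mono[OF _ C(1), of "(q - p)\<^sup>2" "(2 * R * cmod a)\<^sup>2"]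
      by (simp add: \<rho>_def power_mult_distrib)
    have "nls \<sigma> (z + a) - nls \<sigma> z
        - (((cmod z)\<^sup>2) ^ \<sigma> *\<^sub>R a + (2 * real \<sigma> * ((cmod z)\<^sup>2) ^ (\<sigma> - 1) * (z \<bullet> a)) *\<^sub>R z)
        = (q ^ \<sigma>) *\<^sub>R (z + a) - (p ^ \<sigma>) *\<^sub>R z - ((p ^ \<sigma>) *\<^sub>R a + (l * (q - p - (cmod a)\<^sup>2)) *\<^sub>R z)"
      by (simp add: nls_def p_def q_def l_def qp[unfolded p_def q_def] mult_ac)
    also have "\<dots> = (\<rho> + l * (q - p)) *\<^sub>R a + (\<rho> + l * (cmod a)\<^sup>2) *\<^sub>R z"
      by (simp add: \<rho>_def l_def algebra_simps)
    also have "cmod \<dots> \<le> (\<bar>\<rho>\<bar> + l * \<bar>q - p\<bar>) * cmod a + (\<bar>\<rho>\<bar> + l * (cmod a)\<^sup>2) * cmod z"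
      using l(1) abs_triangle_ineq[of \<rho> "l * (q - p)"] abs_triangle_ineq[of \<rho> "l * (cmod a)\<^sup>2"]
      by (intro order_trans[OF norm_triangle_ineq] add_mono) (auto simp: abs_mult intro!: mult_right_mono)
    also have "\<dots> \<le> (4 * C * R\<^sup>2 * (cmod a)\<^sup>2 * (2 * R) + L * (2 * R * cmod a) * cmod a)
        + (4 * C * R\<^sup>2 * (cmod a)\<^sup>2 + L * (cmod a)\<^sup>2) * R"
      using \<rho> l a z(1) qp_le assms C(1) unfolding distrib_right[of _ _ "cmod a"]
      by (intro add_mono mult_mono) auto
    also have "\<dots> = (8 * C * R ^ 3 + 2 * R * L + (4 * C * R\<^sup>2 + L) * R) * (cmod a)\<^sup>2"
      by (simp add: algebra_simps power2_eq_square power3_eq_cube)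
    finally show "cmod (nls \<sigma> (z + a) - nls \<sigma> z
        - (((cmod z)\<^sup>2) ^ \<sigma> *\<^sub>R a + (2 * real \<sigma> * ((cmod z)\<^sup>2) ^ (\<sigma> - 1) * (z \<bullet> a)) *\<^sub>R z))
      \<le> (8 * C * R ^ 3 + 2 * R * L + (4 * C * R\<^sup>2 + L) * R) * (cmod a)\<^sup>2" .
  qed (use C assms in \<open>auto simp: L_def\<close>)
qed

text \<open>The nonlinearity is the gradient of
  \<open>cmod z ^ (2 * \<sigma> + 2) / (2 * \<sigma> + 2)\<close>, so its derivative
  \<open>D z\<close> is symmetric for the real inner product. The linear parts cancel and only the
  two quadratic remainders are left.\<close>

lemma nls_increments_almost_symmetric:
  assumes "0 \<le> R"
  obtains C where "0 \<le> C" "\<And>z a b. cmod z \<le> R \<Longrightarrow> cmod (z + a) \<le> R \<Longrightarrow> cmod (z + b) \<le> R \<Longrightarrow>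
    \<bar>(nls \<sigma> (z + a) - nls \<sigma> z) \<bullet> b - a \<bullet> (nls \<sigma> (z + b) - nls \<sigma> z)\<bar>
      \<le> C * (cmod a + cmod b) * (cmod a * cmod b)"
proof -
  define D where "D = (\<lambda>z a. ((cmod z)\<^sup>2) ^ \<sigma> *\<^sub>R a
    + (2 * real \<sigma> * ((cmod z)\<^sup>2) ^ (\<sigma> - 1) * (z \<bullet> a)) *\<^sub>R z)"
  obtain C where C: "C \<ge> 0" "\<And>z a. cmod z \<le> R \<Longrightarrow> cmod (z + a) \<le> R \<Longrightarrow>
    cmod (nls \<sigma> (z + a) - nls \<sigma> z - D z a) \<le> C * (cmod a)\<^sup>2"
    using nls_Taylor[OF assms, of \<sigma>] unfolding D_def by auto
  show thesis
  proof (rule that[OF C(1)])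
    fix z a b assume z: "cmod z \<le> R" "cmod (z + a) \<le> R" "cmod (z + b) \<le> R"
    define ra rb where "ra = nls \<sigma> (z + a) - nls \<sigma> z - D z a"
      and "rb = nls \<sigma> (z + b) - nls \<sigma> z - D z b"
    have "D z a \<bullet> b = a \<bullet> D z b"
      by (simp add: D_def inner_add inner_commute)
    then have "(nls \<sigma> (z + a) - nls \<sigma> z) \<bullet> b - a \<bullet> (nls \<sigma> (z + b) - nls \<sigma> z) = ra \<bullet> b - a \<bullet> rb"
      by (simp add: ra_def rb_def inner_diff)
    also have "\<bar>\<dots>\<bar> \<le> cmod ra * cmod b + cmod a * cmod rb"
      using Cauchy_Schwarz_ineq2[of ra b] Cauchy_Schwarz_ineq2[of a rb] by linarith
    also have "\<dots> \<le> C * (cmod a)\<^sup>2 * cmod b + cmod a * (C * (cmod b)\<^sup>2)"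
      using C(2)[OF z(1,2)] C(2)[OF z(1,3)]
      by (intro add_mono mult_right_mono mult_left_mono) (auto simp: ra_def rb_def)
    also have "\<dots> = C * (cmod a + cmod b) * (cmod a * cmod b)"
      by (simp add: power2_eq_square algebra_simps)
    finally show "\<bar>(nls \<sigma> (z + a) - nls \<sigma> z) \<bullet> b - a \<bullet> (nls \<sigma> (z + b) - nls \<sigma> z)\<bar>
      \<le> C * (cmod a + cmod b) * (cmod a * cmod b)" .
  qed
qed

section \<open>One step of the scheme solved for its increment\<close>

text \<open>Every other term of the equation is square-integrable, hence so is the Laplacian term.
  This is stated for the product \<open>dw *\<^sub>R l x\<close>, because the equation says nothing
  about \<open>l\<close> when \<open>dw = 0\<close>.\<close>

lemma midpoint_stepE:
  assumes "midpoint_step \<sigma> dt dw f g" "dt \<noteq> 0"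
  obtains l where "has_laplacian (fn (midpoint f g)) l" "square_integrable (\<lambda>x. dw *\<^sub>R l x)"
    "\<And>x. fn g x - fn f x = \<i> * (dw *\<^sub>R l x + dt *\<^sub>R nls \<sigma> (fn (midpoint f g) x))"
proof -
  let ?m = "midpoint f g"
  obtain l where lap: "has_laplacian (fn ?m) l" and
    eq: "\<And>x. \<i> * ((fn g x - fn f x) / complex_of_real dt) + complex_of_real (dw / dt) * l x
      + complex_of_real (cmod (fn ?m x) ^ (2 * \<sigma>)) * fn ?m x = 0"
    using assms(1) unfolding midpoint_step_def Let_def midpoint_def inverse_eq_divide by blast
  have scheme: "dw *\<^sub>R l x = - (\<i> * (fn g x - fn f x)) + (- dt) *\<^sub>R nls \<sigma> (fn ?m x)" for x
  proof -
    have "\<i> * (fn g x - fn f x) + dw *\<^sub>R l x + dt *\<^sub>R nls \<sigma> (fn ?m x)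
      = dt * (\<i> * ((fn g x - fn f x) / complex_of_real dt) + complex_of_real (dw / dt) * l x
      + complex_of_real (cmod (fn ?m x) ^ (2 * \<sigma>)) * fn ?m x)"
      unfolding nls_altdef[symmetric] using assms(2) by (simp add: scaleR_conv_of_real field_simps)
    then show ?thesis unfolding eq by (simp add: eq_neg_iff_add_eq_0 algebra_simps)
  qed
  show thesis
  proof (rule that[OF lap])
    have "square_integrable (\<lambda>x. (- \<i>) * fn (g - f) x + (- dt) *\<^sub>R nls \<sigma> (fn ?m x))"
      by (intro square_integrable_add square_integrable_mult_left square_integrable_scaleR
          square_integrable_fn square_integrable_nls)
    then show "square_integrable (\<lambda>x. dw *\<^sub>R l x)"
      unfolding scheme by simp
    show "fn g x - fn f x = \<i> * (dw *\<^sub>R l x + dt *\<^sub>R nls \<sigma> (fn ?m x))" for x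
      unfolding scheme by (simp add: algebra_simps)
  qed
qed

text \<open>Green's identity in the form matching \<open>midpoint_stepE\<close>: divide by
  \<open>c\<close> if it is nonzero, otherwise the integrand vanishes.\<close>

lemma Green_identity_scaled:
  assumes "square_integrable f" "weak_derivative f f1" "square_integrable g" "weak_derivative g g1"
    and "has_laplacian f l" "has_laplacian g k"
    and "square_integrable (\<lambda>x. c *\<^sub>R l x)" "square_integrable (\<lambda>x. c *\<^sub>R k x)"
  shows "(LINT x|lborel. (c *\<^sub>R l x) \<bullet> g x - f x \<bullet> (c *\<^sub>R k x)) = 0"
proof (cases "c = 0")
  case False
  then have "square_integrable l" "square_integrable k"
    using square_integrable_scaleR[OF assms(7), of "1/c"] square_integrable_scaleR[OF assms(8), of "1/c"]
    by simp_all
  then have "(LINT x|lborel. c * (l x \<bullet> g x - f x \<bullet> k x)) = 0"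
    using Green_identity[OF assms(1-6)] by simp
  then show ?thesis by (simp add: right_diff_distrib)
qed simp

lemma has_laplacian_diff:
  assumes "has_laplacian f l" "has_laplacian g k"
  shows "has_laplacian (\<lambda>x. f x - g x) (\<lambda>x. l x - k x)"
proof -
  obtain f' g' where
    "\<And>x. (f has_vector_derivative f' x) (at x)" "\<And>x. (f' has_vector_derivative l x) (at x)"
    "\<And>x. (g has_vector_derivative g' x) (at x)" "\<And>x. (g' has_vector_derivative k x) (at x)"
    using assms unfolding has_laplacian_def by metis
  then show ?thesis
    unfolding has_laplacian_def
    by (intro exI[of _ "\<lambda>x. f' x - g' x"] allI conjI has_vector_derivative_diff)
qed

lemma has_laplacian_mult_left:
  assumes "has_laplacian f l"
  shows "has_laplacian (\<lambda>x. c * f x) (\<lambda>x. c * l x)"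
proof -
  obtain f' where
    "\<And>x. (f has_vector_derivative f' x) (at x)" "\<And>x. (f' has_vector_derivative l x) (at x)"
    using assms unfolding has_laplacian_def by metis
  then show ?thesis
    unfolding has_laplacian_def
    by (intro exI[of _ "\<lambda>x. c * f' x"] allI conjI has_vector_derivative_mult_right)
qed

lemma weak_derivative_mult_left:
  "weak_derivative f g \<Longrightarrow> weak_derivative (\<lambda>x. c * f x) (\<lambda>x. c * g x)"
  by (simp add: weak_derivative_def square_integrable_mult_left flip: right_diff_distrib)

section \<open>Conservation of charge\<close>

text \<open>Green's identity is applied to the midpoint \<open>m\<close> and to
  \<open>\<i> * m\<close>. As multiplication by \<open>\<i>\<close> is skew, the two terms of that
  identity coincide up to sign, and together they form the change of the squared modulus.\<close>

lemma midpoint_step_charge: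
  assumes "midpoint_step \<sigma> dt dw f g" "dt \<noteq> 0"
  shows "charge g = charge f"
proof -
  let ?m = "fn (midpoint f g)"
  obtain l where l: "has_laplacian ?m l" "square_integrable (\<lambda>x. dw *\<^sub>R l x)"
    "\<And>x. fn g x - fn f x = \<i> * (dw *\<^sub>R l x + dt *\<^sub>R nls \<sigma> (?m x))"
    using midpoint_stepE[OF assms] by blast
  have sq: "square_integrable (\<lambda>x. dw *\<^sub>R (\<i> * l x))"
    using square_integrable_mult_left[OF l(2), of \<i>] by simp
  have "(cmod (fn g x))\<^sup>2 - (cmod (fn f x))\<^sup>2
      = - ((dw *\<^sub>R l x) \<bullet> (\<i> * ?m x) - ?m x \<bullet> (dw *\<^sub>R (\<i> * l x)))" for x
  proof -
    \<comment> \<open>Exact because \<open>m\<close> is the arithmetic mean. In the next line the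
      nonlinear part of the increment drops out, being \<open>\<i>\<close> times a real multiple of
      \<open>m\<close> and so orthogonal to \<open>m\<close>.\<close>
    have "(cmod (fn g x))\<^sup>2 - (cmod (fn f x))\<^sup>2 = 2 * (?m x \<bullet> (fn g x - fn f x))"
      by (simp add: midpoint_def power2_norm_eq_inner inner_add inner_diff inner_commute)
    also have "\<dots> = - ((dw *\<^sub>R l x) \<bullet> (\<i> * ?m x) - ?m x \<bullet> (dw *\<^sub>R (\<i> * l x)))"
      unfolding l(3) by (simp add: inner_complex_def nls_def algebra_simps)
    finally show ?thesis .
  qed
  then have "charge g - charge f
      = (LINT x|lborel. - ((dw *\<^sub>R l x) \<bullet> (\<i> * ?m x) - ?m x \<bullet> (dw *\<^sub>R (\<i> * l x))))"
    unfolding charge_def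
    by (subst Bochner_Integration.integral_diff[symmetric]) (simp_all add: integrable_norm_fn)
  also have "\<dots> = 0"
    unfolding Bochner_Integration.integral_minus
    using Green_identity_scaled[OF square_integrable_fn weak_derivative_wderiv
        square_integrable_mult_left[OF square_integrable_fn]
        weak_derivative_mult_left[OF weak_derivative_wderiv] l(1)
        has_laplacian_mult_left[OF l(1), of \<i>] l(2) sq] by simp
  finally show ?thesis by simp
qed

section \<open>Almost invariance of the pairing under one step\<close>

text \<open>The constant is chosen before the three solutions and is uniform over midpoints in a
  ball, as required for solutions that approach each other.\<close>

lemma midpoint_step_pairing_defect:
  assumes "0 \<le> R" "dt \<noteq> 0"
  obtains C where "\<And>f g f1 g1 f2 g2. midpoint_step \<sigma> dt dw f g \<Longrightarrow>
    midpoint_step \<sigma> dt dw f1 g1 \<Longrightarrow> midpoint_step \<sigma> dt dw f2 g2 \<Longrightarrow>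
    norm (midpoint f g) \<le> R \<Longrightarrow> norm (midpoint f1 g1) \<le> R \<Longrightarrow> norm (midpoint f2 g2) \<le> R \<Longrightarrow>
    \<bar>symplectic_pairing (g1 - g) (g2 - g) - symplectic_pairing (f1 - f) (f2 - f)\<bar>
      \<le> C * (norm (midpoint f1 g1 - midpoint f g) + norm (midpoint f2 g2 - midpoint f g))
          * ((norm (midpoint f1 g1 - midpoint f g))\<^sup>2 + (norm (midpoint f2 g2 - midpoint f g))\<^sup>2)"
proof -
  \<comment> \<open>Midpoints of norm at most \<open>R\<close> have pointwise values of modulus at
    most \<open>2 * R\<close> by the embedding.\<close>
  obtain C where C: "0 \<le> C" "\<And>z a b. cmod z \<le> 2 * R \<Longrightarrow> cmod (z + a) \<le> 2 * R \<Longrightarrow> cmod (z + b) \<le> 2 * R \<Longrightarrow>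
    \<bar>(nls \<sigma> (z + a) - nls \<sigma> z) \<bullet> b - a \<bullet> (nls \<sigma> (z + b) - nls \<sigma> z)\<bar>
      \<le> C * (cmod a + cmod b) * (cmod a * cmod b)"
    using nls_increments_almost_symmetric[of "2 * R" \<sigma>] assms(1) by auto
  show thesis
  proof (rule that[of "\<bar>dt\<bar> * (2 * C)"])
    fix f g f1 g1 f2 g2
    assume step: "midpoint_step \<sigma> dt dw f g" "midpoint_step \<sigma> dt dw f1 g1" "midpoint_step \<sigma> dt dw f2 g2"
      and R: "norm (midpoint f g) \<le> R" "norm (midpoint f1 g1) \<le> R" "norm (midpoint f2 g2) \<le> R"
    define m m1 m2 where m: "m = midpoint f g" "m1 = midpoint f1 g1" "m2 = midpoint f2 g2"
    define a b where ab: "a = m1 - m" "b = m2 - m"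
    obtain l l1 l2 where
      l: "has_laplacian (fn m) l" "square_integrable (\<lambda>x. dw *\<^sub>R l x)"
        "\<And>x. fn g x - fn f x = \<i> * (dw *\<^sub>R l x + dt *\<^sub>R nls \<sigma> (fn m x))" and
      l1: "has_laplacian (fn m1) l1" "square_integrable (\<lambda>x. dw *\<^sub>R l1 x)"
        "\<And>x. fn g1 x - fn f1 x = \<i> * (dw *\<^sub>R l1 x + dt *\<^sub>R nls \<sigma> (fn m1 x))" and
      l2: "has_laplacian (fn m2) l2" "square_integrable (\<lambda>x. dw *\<^sub>R l2 x)"
        "\<And>x. fn g2 x - fn f2 x = \<i> * (dw *\<^sub>R l2 x + dt *\<^sub>R nls \<sigma> (fn m2 x))"
      using step[THEN midpoint_stepE, OF assms(2)] unfolding m by metis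
    define la lb where lab: "la = (\<lambda>x. l1 x - l x)" "lb = (\<lambda>x. l2 x - l x)"
    define Na Nb where Nab: "Na = (\<lambda>x. nls \<sigma> (fn m1 x) - nls \<sigma> (fn m x))"
      "Nb = (\<lambda>x. nls \<sigma> (fn m2 x) - nls \<sigma> (fn m x))"
    have lap: "has_laplacian (fn a) la" "has_laplacian (fn b) lb"
      using has_laplacian_diff[OF l1(1) l(1)] has_laplacian_diff[OF l2(1) l(1)]
      by (simp_all add: ab lab minus_sobolev1.rep_eq)
    have sq: "square_integrable (\<lambda>x. dw *\<^sub>R la x)" "square_integrable (\<lambda>x. dw *\<^sub>R lb x)"
      "square_integrable Na" "square_integrable Nb"
      using square_integrable_add[OF l1(2) square_integrable_scaleR[OF l(2), of "-1"]]
        square_integrable_add[OF l2(2) square_integrable_scaleR[OF l(2), of "-1"]]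
        square_integrable_add[OF square_integrable_nls square_integrable_scaleR[OF square_integrable_nls, of "-1"]]
      by (simp_all add: lab Nab scaleR_diff_right)
    have pointwise: "(\<i> * fn (g1 - g) x) \<bullet> fn (g2 - g) x - (\<i> * fn (f1 - f) x) \<bullet> fn (f2 - f) x
        = - ((dw *\<^sub>R la x) \<bullet> fn b x - fn a x \<bullet> (dw *\<^sub>R lb x)) - dt * (Na x \<bullet> fn b x - fn a x \<bullet> Nb x)" for x
    proof -
      define X Y X' Y' where XY: "X = fn (f1 - f) x" "Y = fn (f2 - f) x" "X' = fn (g1 - g) x" "Y' = fn (g2 - g) x"
      have "X' - X = \<i> * (dw *\<^sub>R la x + dt *\<^sub>R Na x)" "Y' - Y = \<i> * (dw *\<^sub>R lb x + dt *\<^sub>R Nb x)"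
        using l(3)[of x] l1(3)[of x] l2(3)[of x]
        by (simp_all add: XY lab Nab algebra_simps)
      moreover have "fn a x = (1/2) *\<^sub>R (X + X')" "fn b x = (1/2) *\<^sub>R (Y + Y')"
        by (simp_all add: XY ab m midpoint_def algebra_simps)
      \<comment> \<open>A discrete product rule valid for every bilinear form; the arithmetic means
        are exactly the midpoint differences at which the scheme evaluates its right-hand
        side.\<close>
      moreover have "(\<i> * X') \<bullet> Y' - (\<i> * X) \<bullet> Y
          = (\<i> * (X' - X)) \<bullet> ((1/2) *\<^sub>R (Y + Y')) + (\<i> * ((1/2) *\<^sub>R (X + X'))) \<bullet> (Y' - Y)"
        by (simp add: inner_complex_def field_simps)
      ultimately have "(\<i> * X') \<bullet> Y' - (\<i> * X) \<bullet> Y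
          = (\<i> * (\<i> * (dw *\<^sub>R la x + dt *\<^sub>R Na x))) \<bullet> fn b x + (\<i> * fn a x) \<bullet> (\<i> * (dw *\<^sub>R lb x + dt *\<^sub>R Nb x))"
        by simp
      then show ?thesis
        unfolding XY by (simp add: inner_complex_def algebra_simps)
    qed
    have int: "integrable lborel (\<lambda>x. (dw *\<^sub>R la x) \<bullet> fn b x - fn a x \<bullet> (dw *\<^sub>R lb x))"
      "integrable lborel (\<lambda>x. Na x \<bullet> fn b x - fn a x \<bullet> Nb x)"
      by (intro Bochner_Integration.integrable_diff square_integrable_inner sq square_integrable_fn)+
    have Green: "(LINT x|lborel. (dw *\<^sub>R la x) \<bullet> fn b x - fn a x \<bullet> (dw *\<^sub>R lb x)) = 0"
      by (rule Green_identity_scaled[OF square_integrable_fn weak_derivative_wderiv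
            square_integrable_fn weak_derivative_wderiv lap sq(1,2)])
    have "symplectic_pairing (g1 - g) (g2 - g) - symplectic_pairing (f1 - f) (f2 - f)
        = (LINT x|lborel. - ((dw *\<^sub>R la x) \<bullet> fn b x - fn a x \<bullet> (dw *\<^sub>R lb x)) - dt * (Na x \<bullet> fn b x - fn a x \<bullet> Nb x))"
      unfolding symplectic_pairing_def pointwise[symmetric]
      by (rule Bochner_Integration.integral_diff[symmetric]; rule integrable_symplectic_pairing)
    also have "\<dots> = - (LINT x|lborel. (dw *\<^sub>R la x) \<bullet> fn b x - fn a x \<bullet> (dw *\<^sub>R lb x))
        - dt * (LINT x|lborel. Na x \<bullet> fn b x - fn a x \<bullet> Nb x)"
      unfolding integral_minus[symmetric] integral_mult_right_zero[symmetric]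
      by (rule Bochner_Integration.integral_diff) (intro integrable_minus integrable_mult_right int)+
    finally have eq: "\<bar>symplectic_pairing (g1 - g) (g2 - g) - symplectic_pairing (f1 - f) (f2 - f)\<bar>
        = \<bar>dt\<bar> * \<bar>LINT x|lborel. Na x \<bullet> fn b x - fn a x \<bullet> Nb x\<bar>"
      unfolding Green by (simp add: abs_mult)
    have "\<bar>LINT x|lborel. Na x \<bullet> fn b x - fn a x \<bullet> Nb x\<bar> \<le> (LINT x|lborel. \<bar>Na x \<bullet> fn b x - fn a x \<bullet> Nb x\<bar>)"
      by (rule integral_abs_bound)
    \<comment> \<open>Of the three factors one is estimated uniformly by the embedding, which costs
      the factor 2; the other two stay under the integral as squares.\<close>
    also have "\<dots> \<le> (LINT x|lborel. C * (2 * (norm a + norm b)) * ((cmod (fn a x))\<^sup>2 + (cmod (fn b x))\<^sup>2))"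
    proof (intro integral_mono integrable_abs int integrable_mult_right Bochner_Integration.integrable_add integrable_norm_fn)
      fix x
      have "\<bar>Na x \<bullet> fn b x - fn a x \<bullet> Nb x\<bar> \<le> C * (cmod (fn a x) + cmod (fn b x)) * (cmod (fn a x) * cmod (fn b x))"
        using C(2)[of "fn m x" "fn a x" "fn b x"] R norm_fn_le[of m x] norm_fn_le[of m1 x] norm_fn_le[of m2 x]
        by (simp add: Nab ab m)
      also have "\<dots> \<le> C * (2 * (norm a + norm b)) * ((cmod (fn a x))\<^sup>2 + (cmod (fn b x))\<^sup>2)"
        using C(1) norm_fn_le[of a x] norm_fn_le[of b x] mult_le_sum_squares
        by (intro mult_mono) auto
      finally show "\<bar>Na x \<bullet> fn b x - fn a x \<bullet> Nb x\<bar>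
          \<le> C * (2 * (norm a + norm b)) * ((cmod (fn a x))\<^sup>2 + (cmod (fn b x))\<^sup>2)" .
    qed
    also have "\<dots> = C * (2 * (norm a + norm b)) * ((LINT x|lborel. (cmod (fn a x))\<^sup>2) + (LINT x|lborel. (cmod (fn b x))\<^sup>2))"
      by (simp add: integrable_norm_fn)
    also have "\<dots> \<le> C * (2 * (norm a + norm b)) * ((norm a)\<^sup>2 + (norm b)\<^sup>2)"
      using C(1) integral_norm_fn_le by (intro mult_left_mono add_mono) auto
    finally have "\<bar>dt\<bar> * \<bar>LINT x|lborel. Na x \<bullet> fn b x - fn a x \<bullet> Nb x\<bar>
        \<le> \<bar>dt\<bar> * (C * (2 * (norm a + norm b)) * ((norm a)\<^sup>2 + (norm b)\<^sup>2))"
      by (rule mult_left_mono) simp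
    then show "\<bar>symplectic_pairing (g1 - g) (g2 - g) - symplectic_pairing (f1 - f) (f2 - f)\<bar>
      \<le> \<bar>dt\<bar> * (2 * C) * (norm (midpoint f1 g1 - midpoint f g) + norm (midpoint f2 g2 - midpoint f g))
          * ((norm (midpoint f1 g1 - midpoint f g))\<^sup>2 + (norm (midpoint f2 g2 - midpoint f g))\<^sup>2)"
      unfolding eq ab m by (simp add: mult_ac)
  qed
qed

section \<open>From finite differences to derivatives of the flow\<close>

lemma directional_derivative_tendsto:
  assumes "(f has_derivative f') (at x)"
  shows "((\<lambda>t. (f (x + t *\<^sub>R \<xi>) - f x) /\<^sub>R t) \<longlongrightarrow> f' \<xi>) (at 0)"
proof -
  have "((\<lambda>t. f (x + t *\<^sub>R \<xi>)) has_derivative (\<lambda>t. f' (t *\<^sub>R \<xi>))) (at 0)"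
    using assms by (intro has_derivative_compose[of "\<lambda>t. x + t *\<^sub>R \<xi>" _ _ _ f]) (auto intro!: derivative_eq_intros)
  then have "((\<lambda>t. f (x + t *\<^sub>R \<xi>)) has_vector_derivative f' \<xi>) (at 0)"
    using linear_scale[OF has_derivative_linear[OF assms]] by (simp add: has_vector_derivative_def)
  then have "((\<lambda>t. norm (f (x + t *\<^sub>R \<xi>) - f x - t *\<^sub>R f' \<xi>) / norm t) \<longlongrightarrow> 0) (at 0)"
    by (simp add: has_vector_derivative_def has_derivative_at)
  moreover have "\<forall>\<^sub>F t in at 0. norm (f (x + t *\<^sub>R \<xi>) - f x - t *\<^sub>R f' \<xi>) / norm t
      = norm ((f (x + t *\<^sub>R \<xi>) - f x) /\<^sub>R t - f' \<xi>)"
    using eventually_neq_at_within[of 0]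
  proof eventually_elim
    case (elim t)
    then have "(f (x + t *\<^sub>R \<xi>) - f x) /\<^sub>R t - f' \<xi> = (f (x + t *\<^sub>R \<xi>) - f x - t *\<^sub>R f' \<xi>) /\<^sub>R t"
      by (simp add: scaleR_diff_right)
    then show ?case by (simp add: divide_inverse)
  qed
  ultimately have "((\<lambda>t. norm ((f (x + t *\<^sub>R \<xi>) - f x) /\<^sub>R t - f' \<xi>)) \<longlongrightarrow> 0) (at 0)"
    by (rule Lim_transform_eventually)
  then show ?thesis
    by (rule LIM_zero_cancel[OF tendsto_norm_zero_cancel])
qed

text \<open>The difference \<open>E\<close> of the pairings of the difference quotients has two
  limits: the difference of the pairings of the derivatives, by continuity, and zero, since a
  third-order defect divided by \<open>t\<^sup>2\<close> keeps a factor
  \<open>\<bar>t\<bar>\<close>.\<close>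

lemma flow_step_pairing:
  fixes u0 :: "'a :: real_normed_vector"
  assumes step: "\<forall>\<^sub>F \<phi> in nhds u0. midpoint_step \<sigma> dt dw (U \<phi>) (V \<phi>)" and dt: "dt \<noteq> 0"
    and U: "(U has_derivative U') (at u0)" and V: "(V has_derivative V') (at u0)"
  shows "symplectic_pairing (V' \<xi>) (V' \<eta>) = symplectic_pairing (U' \<xi>) (U' \<eta>)"
proof -
  interpret pairing: bounded_bilinear symplectic_pairing by (rule bounded_bilinear_symplectic_pairing)
  define P where "P = (\<lambda>\<phi>. midpoint (U \<phi>) (V \<phi>))"
  have P: "(P has_derivative (\<lambda>\<xi>. midpoint (U' \<xi>) (V' \<xi>))) (at u0)"
    unfolding P_def midpoint_def by (intro derivative_intros U V)
  \<comment> \<open>The margin 1 lets the ball contain all midpoints for data near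
    \<open>u0\<close>, by continuity of \<open>P\<close>.\<close>
  define R where "R = norm (P u0) + 1"
  obtain C where C: "\<And>f g f1 g1 f2 g2. midpoint_step \<sigma> dt dw f g \<Longrightarrow>
    midpoint_step \<sigma> dt dw f1 g1 \<Longrightarrow> midpoint_step \<sigma> dt dw f2 g2 \<Longrightarrow>
    norm (midpoint f g) \<le> R \<Longrightarrow> norm (midpoint f1 g1) \<le> R \<Longrightarrow> norm (midpoint f2 g2) \<le> R \<Longrightarrow>
    \<bar>symplectic_pairing (g1 - g) (g2 - g) - symplectic_pairing (f1 - f) (f2 - f)\<bar>
      \<le> C * (norm (midpoint f1 g1 - midpoint f g) + norm (midpoint f2 g2 - midpoint f g))
          * ((norm (midpoint f1 g1 - midpoint f g))\<^sup>2 + (norm (midpoint f2 g2 - midpoint f g))\<^sup>2)"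
    using midpoint_step_pairing_defect[of R dt \<sigma> dw] dt by (auto simp: R_def)
  define \<Delta> :: "('a \<Rightarrow> sobolev1) \<Rightarrow> 'a \<Rightarrow> real \<Rightarrow> sobolev1"
    where "\<Delta> = (\<lambda>f \<zeta> t. (f (u0 + t *\<^sub>R \<zeta>) - f u0) /\<^sub>R t)"
  have \<Delta>: "(\<Delta> f \<zeta> \<longlongrightarrow> f' \<zeta>) (at 0)" if "(f has_derivative f') (at u0)" for f f' \<zeta>
    unfolding \<Delta>_def using that by (rule directional_derivative_tendsto)
  have line: "filterlim (\<lambda>t. u0 + t *\<^sub>R \<zeta>) (nhds u0) (at 0)" for \<zeta>
  proof -
    have "((\<lambda>t. u0 + t *\<^sub>R \<zeta>) \<longlongrightarrow> u0 + 0 *\<^sub>R \<zeta>) (at 0)" by (intro tendsto_intros)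
    then show ?thesis by simp
  qed
  have "(P \<longlongrightarrow> P u0) (nhds u0)"
    using has_derivative_continuous[OF P] by (simp add: isCont_def continuous_within tendsto_at_iff_tendsto_nhds)
  then have "\<forall>\<^sub>F \<phi> in nhds u0. dist (P \<phi>) (P u0) < 1" by (rule tendstoD) simp
  then have "\<forall>\<^sub>F \<phi> in nhds u0. norm (P \<phi>) \<le> R"
  proof eventually_elim
    case (elim \<phi>)
    then show ?case
      using norm_triangle_sub[of "P \<phi>" "P u0"] by (simp add: R_def dist_norm)
  qed
  with step have good: "\<forall>\<^sub>F \<phi> in nhds u0. midpoint_step \<sigma> dt dw (U \<phi>) (V \<phi>) \<and> norm (P \<phi>) \<le> R"
    by eventually_elim simp
  have good_line: "\<forall>\<^sub>F t in at 0. midpoint_step \<sigma> dt dw (U (u0 + t *\<^sub>R \<zeta>)) (V (u0 + t *\<^sub>R \<zeta>)) \<and>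
      norm (P (u0 + t *\<^sub>R \<zeta>)) \<le> R" for \<zeta>
    using line[of \<zeta>] good by (rule eventually_compose_filterlim[rotated])
  define E where "E = (\<lambda>t. symplectic_pairing (\<Delta> V \<xi> t) (\<Delta> V \<eta> t) - symplectic_pairing (\<Delta> U \<xi> t) (\<Delta> U \<eta> t))"
  have "\<forall>\<^sub>F t in at 0. norm (E t) \<le> C * \<bar>t\<bar> * (norm (\<Delta> P \<xi> t) + norm (\<Delta> P \<eta> t))
      * ((norm (\<Delta> P \<xi> t))\<^sup>2 + (norm (\<Delta> P \<eta> t))\<^sup>2)"
    using good_line[of \<xi>] good_line[of \<eta>] eventually_neq_at_within[of 0]
  proof eventually_elim
    case (elim t)
    have scale: "f (u0 + t *\<^sub>R \<zeta>) - f u0 = t *\<^sub>R \<Delta> f \<zeta> t" for f \<zeta>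
      using elim(3) by (simp add: \<Delta>_def)
    have "\<bar>symplectic_pairing (t *\<^sub>R \<Delta> V \<xi> t) (t *\<^sub>R \<Delta> V \<eta> t) - symplectic_pairing (t *\<^sub>R \<Delta> U \<xi> t) (t *\<^sub>R \<Delta> U \<eta> t)\<bar>
      \<le> C * (norm (t *\<^sub>R \<Delta> P \<xi> t) + norm (t *\<^sub>R \<Delta> P \<eta> t))
          * ((norm (t *\<^sub>R \<Delta> P \<xi> t))\<^sup>2 + (norm (t *\<^sub>R \<Delta> P \<eta> t))\<^sup>2)"
      \<comment> \<open>The base solution is the one started at \<open>u0\<close> itself, which the
        filter \<open>nhds u0\<close> includes.\<close>
      unfolding scale[symmetric] P_def using elim(1,2) eventually_nhds_x_imp_x[OF good]
      by (intro C) (auto simp: P_def)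
    moreover have "symplectic_pairing (t *\<^sub>R \<Delta> V \<xi> t) (t *\<^sub>R \<Delta> V \<eta> t)
        - symplectic_pairing (t *\<^sub>R \<Delta> U \<xi> t) (t *\<^sub>R \<Delta> U \<eta> t) = t\<^sup>2 * E t"
      by (simp add: E_def pairing.scaleR_left pairing.scaleR_right power2_eq_square right_diff_distrib)
    moreover have "C * (norm (t *\<^sub>R \<Delta> P \<xi> t) + norm (t *\<^sub>R \<Delta> P \<eta> t))
          * ((norm (t *\<^sub>R \<Delta> P \<xi> t))\<^sup>2 + (norm (t *\<^sub>R \<Delta> P \<eta> t))\<^sup>2)
      = t\<^sup>2 * (C * \<bar>t\<bar> * (norm (\<Delta> P \<xi> t) + norm (\<Delta> P \<eta> t))
          * ((norm (\<Delta> P \<xi> t))\<^sup>2 + (norm (\<Delta> P \<eta> t))\<^sup>2))"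
      by (simp add: power_mult_distrib algebra_simps)
    ultimately have "t\<^sup>2 * \<bar>E t\<bar> \<le> t\<^sup>2 * (C * \<bar>t\<bar> * (norm (\<Delta> P \<xi> t) + norm (\<Delta> P \<eta> t))
      * ((norm (\<Delta> P \<xi> t))\<^sup>2 + (norm (\<Delta> P \<eta> t))\<^sup>2))"
      by (simp only: abs_mult) simp
    then show ?case
      unfolding real_norm_def by (rule mult_left_le_imp_le) (use elim(3) in simp)
  qed
  moreover have "((\<lambda>t. C * \<bar>t\<bar> * (norm (\<Delta> P \<xi> t) + norm (\<Delta> P \<eta> t))
      * ((norm (\<Delta> P \<xi> t))\<^sup>2 + (norm (\<Delta> P \<eta> t))\<^sup>2)) \<longlongrightarrow> 0) (at 0)"
    by (rule tendsto_eq_intros \<Delta>[OF P] refl | simp)+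
  ultimately have "(E \<longlongrightarrow> 0) (at 0)" by (rule Lim_null_comparison)
  moreover have "(E \<longlongrightarrow> symplectic_pairing (V' \<xi>) (V' \<eta>) - symplectic_pairing (U' \<xi>) (U' \<eta>)) (at 0)"
    unfolding E_def by (intro tendsto_diff pairing.tendsto \<Delta> U V)
  ultimately show ?thesis
    using tendsto_unique[of "at (0::real)" E] by fastforce
qed

section \<open>The two-form of the flow and the conclusion\<close>

text \<open>Point evaluation, \<open>Re\<close> and \<open>Im\<close> are bounded linear and so
  commute with the derivative; the wedge then becomes the integrand of the pairing.\<close>

lemma symplectic_form_eq_pairing:
  assumes "(U has_derivative U') (at u0)"
  shows "symplectic_form U u0 \<xi> \<eta> = symplectic_pairing (U' \<xi>) (U' \<eta>)"
proof -
  have fn: "((\<lambda>\<phi>. fn (U \<phi>) x) has_derivative (\<lambda>\<xi>. fn (U' \<xi>) x)) (at u0)" for x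
    using bounded_linear.has_derivative[OF bounded_linear_fn assms] .
  have "ext_d (\<lambda>\<phi>. Re (fn (U \<phi>) x)) u0 = (\<lambda>\<xi>. Re (fn (U' \<xi>) x))"
    "ext_d (\<lambda>\<phi>. Im (fn (U \<phi>) x)) u0 = (\<lambda>\<xi>. Im (fn (U' \<xi>) x))" for x
    using frechet_derivative_at[OF bounded_linear.has_derivative[OF bounded_linear_Re fn]]
      frechet_derivative_at[OF bounded_linear.has_derivative[OF bounded_linear_Im fn]]
    by (simp_all add: ext_d_def)
  then show ?thesis
    by (simp add: symplectic_form_def symplectic_pairing_def wedge_def inner_complex_def algebra_simps)
qed

theorem proposition3p1:
  fixes M :: "'w measure" and F :: "real \<Rightarrow> 'w measure" and W :: "real \<Rightarrow> 'w \<Rightarrow> real"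
    and T :: real and N \<sigma> :: nat
    and u0 :: "'w \<Rightarrow> sobolev1" and u :: "nat \<Rightarrow> 'w \<Rightarrow> sobolev1 \<Rightarrow> sobolev1"
  assumes "stochastic_basis M F" and "brownian_motion M F W"
    and "T > 0" and "N \<ge> 1" and "1 \<le> \<sigma>" and "\<sigma> \<le> 2"
    and "AE \<omega> in M. midpoint_scheme \<sigma> T N (\<lambda>t. W t \<omega>) (u0 \<omega>) (\<lambda>n. u n \<omega> (u0 \<omega>))"
  shows "AE \<omega> in M. \<forall>n<N.
      (differentiable_midpoint_flow \<sigma> T N (\<lambda>t. W t \<omega>) (u0 \<omega>) (\<lambda>m. u m \<omega>) \<longrightarrow>
         symplectic_form (u (Suc n) \<omega>) (u0 \<omega>) = symplectic_form (u n \<omega>) (u0 \<omega>)) \<and>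
      charge (u (Suc n) \<omega> (u0 \<omega>)) = charge (u n \<omega> (u0 \<omega>))"
  using assms(7)
proof eventually_elim
  case (elim \<omega>)
  let ?dt = "T / real N"
  have dt: "?dt \<noteq> 0" using assms(3,4) by simp
  show ?case
  proof (intro allI impI conjI)
    fix n assume n: "n < N"
    let ?dw = "W (real (Suc n) * ?dt) \<omega> - W (real n * ?dt) \<omega>"
    have "midpoint_step \<sigma> ?dt ?dw (u n \<omega> (u0 \<omega>)) (u (Suc n) \<omega> (u0 \<omega>))"
      using elim n unfolding midpoint_scheme_def Let_def by blast
    then show "charge (u (Suc n) \<omega> (u0 \<omega>)) = charge (u n \<omega> (u0 \<omega>))"
      using dt by (rule midpoint_step_charge)
    assume flow: "differentiable_midpoint_flow \<sigma> T N (\<lambda>t. W t \<omega>) (u0 \<omega>) (\<lambda>m. u m \<omega>)"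
    then have "\<forall>\<^sub>F \<phi> in nhds (u0 \<omega>). midpoint_scheme \<sigma> T N (\<lambda>t. W t \<omega>) \<phi> (\<lambda>n. u n \<omega> \<phi>)"
      by (simp add: differentiable_midpoint_flow_def)
    \<comment> \<open>The path is fixed, so the same increment \<open>?dw\<close> drives the
      solutions from all nearby initial data, and they can be compared within a single step.\<close>
    then have step: "\<forall>\<^sub>F \<phi> in nhds (u0 \<omega>). midpoint_step \<sigma> ?dt ?dw (u n \<omega> \<phi>) (u (Suc n) \<omega> \<phi>)"
      by eventually_elim (use n in \<open>simp add: midpoint_scheme_def Let_def\<close>)
    obtain U' V' where "(u n \<omega> has_derivative U') (at (u0 \<omega>))" "(u (Suc n) \<omega> has_derivative V') (at (u0 \<omega>))"
      using flow n unfolding differentiable_midpoint_flow_def differentiable_def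
      by (meson Suc_leI less_imp_le)
    then show "symplectic_form (u (Suc n) \<omega>) (u0 \<omega>) = symplectic_form (u n \<omega>) (u0 \<omega>)"
      using flow_step_pairing[OF step dt] by (intro ext) (simp add: symplectic_form_eq_pairing)
  qed
qed

end
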